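(* Let $n\ge 3$ and $S=\{1,\ldots,n\}$. The cell-form map $$f:\mathcal{P}_{S\cup\{d\}}\longrightarrow H^{n-2}(\mathfrak{M}_{0,n+1})$$ is surjective with kernel equal to the subspace $I_S$.
   Context: $\mathcal{P}_{S\cup\{d\}}$ is the $\mathbb{Q}$-vector space with basis the cyclic orderings of the $(n+1)$-element set $S\cup\{d\}$ (viewed as oriented planar polygons with edges labelled by $S\cup\{d\}$, up to rotation). Every cyclic ordering is written uniquely as $(w,d)$ with $w$ a word using each letter of $S$ exactly once. $I_S\subset\mathcal{P}_{S\cup\{d\}}$ is the subspace spanned by the elements $(A\,\text{ш}\,B,d)$, where $A,B$ are nonempty words with distinct letters whose sets of letters are disjoint with union $S$, and $A\,\text{ш}\,B$ is the usual shuffle product (the sum of all interleavings). $\mathfrak{M}_{0,n+1}=\{(t_1,\ldots,t_{n-2}): t_i\neq 0,1,\infty,\ t_i\ne t_j \text{ for }i\ne j\}$ is the moduli space of genus $0$ curves with $n+1$ ordered marked points, put in the form $(0,t_1,\ldots,t_{n-2},1,\infty)$; $H^{n-2}(\mathfrak{M}_{0,n+1})$ is its algebraic de Rham cohomology over $\mathbb{Q}$. Let $\rho$ send $1,2,\ldots,n-1,n,d$ to $0,t_1,\ldots,t_{n-2},1,\infty$ respectively. The linear map $f$ sends $(i_1,\ldots,i_n,d)$ to the class of the cell-form $$[\rho(i_1),\ldots,\rho(i_n),\infty]=\frac{dt_1\cdots dt_{n-2}}{(\rho(i_2)-\rho(i_1))(\rho(i_3)-\rho(i_2))\cdots(\rho(i_n)-\rho(i_{n-1}))}.$$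 *)

theory Defs
  imports
    Complex_Main
    "HOL-Library.Poly_Mapping"
    "HOL-Computational_Algebra.Fraction_Field"
begin

section \<open>Cyclic orderings and shuffles\<close>

text \<open>The set \<open>S \<union> {d}\<close> with \<open>S = {1..n}\<close>; the constructor \<open>D\<close> is the extra label \<open>d\<close>.\<close>

datatype label = Letter nat | D

definition labels :: "nat \<Rightarrow> label set" where
  "labels n = insert D (Letter ` {1..n})"

text \<open>A cyclic ordering of a finite set is the rotation class of a listing of its elements;
  there is no identification of a cyclic ordering with its reversal.\<close>

definition cyc :: "'a list \<Rightarrow> 'a list set" where
  "cyc xs = {rotate k xs | k. True}"

definition cyclic_orderings :: "'a set \<Rightarrow> 'a list set set" where
  "cyclic_orderings X = {cyc xs | xs. distinct xs \<and> set xs = X}"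

text \<open>The cyclic ordering \<open>(w, d)\<close>.\<close>

definition pointed :: "nat list \<Rightarrow> label list set" where
  "pointed w = cyc (map Letter w @ [D])"

definition cell_word :: "label list set \<Rightarrow> nat list" where
  "cell_word c = (THE w. pointed w = c)"

lemma cell_word_pointed: "cell_word (pointed w) = w"
proof -
  have inj: "v = w" if eq: "pointed v = pointed w" for v w
  proof -
    have "map Letter v @ [D] \<in> pointed v"
      unfolding pointed_def cyc_def by (auto intro: exI[of _ 0])
    then obtain k where k: "map Letter v @ [D] = rotate k (map Letter w @ [D])"
      using eq unfolding pointed_def cyc_def by blast
    define m where "m = k mod Suc (length w)"
    have m: "m \<le> length w" unfolding m_def
      by (metis less_Suc_eq_le mod_less_divisor zero_less_Suc)
    have e: "map Letter v @ [D] = drop m (map Letter w @ [D]) @ take m (map Letter w @ [D])"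
      using k by (simp add: rotate_drop_take m_def)
    show "v = w"
    proof (cases "m = 0")
      case True
      then have "map Letter v = map Letter w" using e by simp
      then show ?thesis by (metis injI inj_map_eq_map label.inject)
    next
      case False
      have ne: "take m (map Letter w) \<noteq> []" using m False by auto
      have "D = last (map Letter v @ [D])" by simp
      also have "\<dots> = last (take m (map Letter w))"
        unfolding e using ne m by simp
      finally have "D \<in> set (take m (map Letter w))" using ne last_in_set by metis
      then have "D \<in> set (map Letter w)" by (rule in_set_takeD)
      then show ?thesis by auto
    qed
  qed
  show ?thesis unfolding cell_word_def by (rule the_equality) (rule refl, erule inj)
qed

section \<open>Free rational vector spaces\<close>

definition scaleQ :: "rat \<Rightarrow> ('a \<Rightarrow>\<^sub>0 rat) \<Rightarrow> ('a \<Rightarrow>\<^sub>0 rat)" where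
  "scaleQ c x = Poly_Mapping.map ((*) c) x"

lemma lookup_scaleQ: "Poly_Mapping.lookup (scaleQ c x) a = c * Poly_Mapping.lookup x a"
  by (simp add: scaleQ_def Poly_Mapping.map.rep_eq when_def)

global_interpretation free_rat: vector_space scaleQ
  by unfold_locales
    (auto intro!: poly_mapping_eqI simp: lookup_scaleQ lookup_add algebra_simps)

text \<open>\<open>\<P>\<^bsub>S \<union> {d}\<^esub>\<close> is the subspace of the free vector space that is spanned by the
  cyclic orderings of \<open>S \<union> {d}\<close>.\<close>

definition polygons :: "nat \<Rightarrow> (label list set \<Rightarrow>\<^sub>0 rat) set" where
  "polygons n = {x. Poly_Mapping.keys x \<subseteq> cyclic_orderings (labels n)}"

text \<open>As \<open>A\<close> and \<open>B\<close> will have no letter in common and no repeated letters, distinct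
  interleavings are distinct words, so that the set \<^const>\<open>shuffles\<close> carries no multiplicities.\<close>

definition pointed_shuffle :: "nat list \<Rightarrow> nat list \<Rightarrow> (label list set \<Rightarrow>\<^sub>0 rat)" where
  "pointed_shuffle A B = (\<Sum>w\<in>shuffles A B. Poly_Mapping.single (pointed w) 1)"

definition shuffle_space :: "nat \<Rightarrow> (label list set \<Rightarrow>\<^sub>0 rat) set" where
  "shuffle_space n = free_rat.span {pointed_shuffle A B | A B.
     A \<noteq> [] \<and> B \<noteq> [] \<and> distinct A \<and> distinct B \<and>
     set A \<inter> set B = {} \<and> set A \<union> set B = {1..n}}"

section \<open>Rational functions and their partial derivatives\<close>

type_synonym mpoly = "(nat \<Rightarrow>\<^sub>0 nat) \<Rightarrow>\<^sub>0 rat"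
type_synonym ratfun = "mpoly fract"

abbreviation (input) embed :: "mpoly \<Rightarrow> ratfun" where
  "embed p \<equiv> Fract p 1"

definition ratconst :: "rat \<Rightarrow> ratfun" where
  "ratconst c = embed (Poly_Mapping.single 0 c)"

definition pvar :: "nat \<Rightarrow> mpoly" where
  "pvar i = Poly_Mapping.single (Poly_Mapping.single i 1) 1"

definition tcoord :: "nat \<Rightarrow> ratfun" where
  "tcoord i = embed (pvar i)"

definition pdiff :: "nat \<Rightarrow> mpoly \<Rightarrow> mpoly" where
  "pdiff i p = (\<Sum>m\<in>Poly_Mapping.keys p.
     Poly_Mapping.single (m - Poly_Mapping.single i 1) (of_nat (Poly_Mapping.lookup m i) * Poly_Mapping.lookup p m))"

lemma pdiff_superset:
  assumes "finite A" "Poly_Mapping.keys p \<subseteq> A"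
  shows "pdiff i p = (\<Sum>m\<in>A.
     Poly_Mapping.single (m - Poly_Mapping.single i 1) (of_nat (Poly_Mapping.lookup m i) * Poly_Mapping.lookup p m))"
  unfolding pdiff_def using assms
  by (intro sum.mono_neutral_left) (auto simp: in_keys_iff)

lemma pdiff_add: "pdiff i (p + q) = pdiff i p + pdiff i q"
proof -
  let ?A = "Poly_Mapping.keys p \<union> Poly_Mapping.keys q"
  have "Poly_Mapping.keys (p + q) \<subseteq> ?A" by (rule Poly_Mapping.keys_add)
  then show ?thesis
    by (simp add: pdiff_superset[of ?A] lookup_add ring_distribs single_add sum.distrib)
qed

lemma pdiff_zero [simp]: "pdiff i 0 = 0"
  by (simp add: pdiff_def)

lemma pdiff_single:
  "pdiff i (Poly_Mapping.single m c) =
     Poly_Mapping.single (m - Poly_Mapping.single i 1) (of_nat (Poly_Mapping.lookup m i) * c)"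
  by (simp add: pdiff_superset[of "{m}"])

lemma mpoly_induct [case_names zero add]:
  fixes p :: mpoly
  assumes "P 0" "\<And>m c q. P q \<Longrightarrow> P (Poly_Mapping.single m c + q)"
  shows "P p"
proof -
  have "P (\<Sum>m\<in>A. Poly_Mapping.single m (Poly_Mapping.lookup p m))" if "finite A" for A
    using that by (induction A rule: finite_induct) (simp_all add: assms)
  moreover have "(\<Sum>m\<in>Poly_Mapping.keys p. Poly_Mapping.single m (Poly_Mapping.lookup p m)) = p"
    by (intro poly_mapping_eqI)
       (auto simp: lookup_sum lookup_single when_def in_keys_iff)
  ultimately show ?thesis by (metis finite_keys)
qed

lemma pdiff_mult_single:
  fixes a b :: rat
  shows "pdiff i (Poly_Mapping.single k a * Poly_Mapping.single m b) =
    pdiff i (Poly_Mapping.single k a) * Poly_Mapping.single m b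
    + Poly_Mapping.single k a * pdiff i (Poly_Mapping.single m b)"
proof -
  let ?e = "Poly_Mapping.single i (1::nat)"
  have sub: "(k - ?e) + m = k + m - ?e" if "Poly_Mapping.lookup k i > 0" for k m :: "nat \<Rightarrow>\<^sub>0 nat"
    using that by (intro poly_mapping_eqI) (auto simp: lookup_add lookup_minus lookup_single when_def)
  have 1: "Poly_Mapping.single (k - ?e + m) (of_nat (Poly_Mapping.lookup k i) * c)
      = Poly_Mapping.single (k + m - ?e) (of_nat (Poly_Mapping.lookup k i) * c)"
    for k m :: "nat \<Rightarrow>\<^sub>0 nat" and c :: rat
    by (cases "Poly_Mapping.lookup k i = 0") (simp_all add: sub del: One_nat_def)
  have "pdiff i (Poly_Mapping.single k a) * Poly_Mapping.single m b
    + Poly_Mapping.single k a * pdiff i (Poly_Mapping.single m b)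
    = Poly_Mapping.single (k - ?e + m) (of_nat (Poly_Mapping.lookup k i) * (a * b))
    + Poly_Mapping.single (m - ?e + k) (of_nat (Poly_Mapping.lookup m i) * (a * b))"
    by (simp add: pdiff_single mult_single add.commute mult_ac)
  also have "\<dots> = Poly_Mapping.single (k + m - ?e) (of_nat (Poly_Mapping.lookup (k + m) i) * (a * b))"
    by (simp only: 1 add.commute[of m k])
       (simp add: lookup_add ring_distribs flip: single_add)
  finally show ?thesis by (simp add: mult_single pdiff_single)
qed

lemma pdiff_mult: "pdiff i (p * q) = pdiff i p * q + p * pdiff i q"
proof (induction p rule: mpoly_induct)
  case zero
  show ?case by simp
next
  case (add k a p)
  have "pdiff i (Poly_Mapping.single k a * q)
      = pdiff i (Poly_Mapping.single k a) * q + Poly_Mapping.single k a * pdiff i q"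
    by (induction q rule: mpoly_induct)
       (simp_all add: distrib_left pdiff_add pdiff_mult_single)
  with add show ?case by (simp add: distrib_right pdiff_add)
qed

lemma quotient_rule_cong:
  fixes p q r s p' q' r' s' :: "'a::idom"
  assumes "p * s = r * q" "p' * s + p * s' = r' * q + r * q'"
  shows "(p' * q - p * q') * (s * s) = (r' * s - r * s') * (q * q)"
proof -
  have "(p' * q - p * q') * (s * s) - (r' * s - r * s') * (q * q) =
    q * s * ((p' * s + p * s') - (r' * q + r * q')) - (q * s' + s * q') * (p * s - r * q)"
    by (simp add: algebra_simps)
  also have "\<dots> = 0" by (simp only: assms) simp
  finally show ?thesis by simp
qed

text \<open>The extension of \<^const>\<open>pdiff\<close> to the field of fractions by the quotient rule.\<close>

lift_definition partial_deriv :: "nat \<Rightarrow> ratfun \<Rightarrow> ratfun" is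
  "\<lambda>i (p, q). (pdiff i p * q - p * pdiff i q, q * q)"
proof -
  fix i and x y :: "mpoly \<times> mpoly"
  obtain p q r s where [simp]: "x = (p, q)" "y = (r, s)" by (cases x, cases y) auto
  assume "fractrel x y"
  then have nz: "q \<noteq> 0" "s \<noteq> 0" and e: "p * s = r * q" by auto
  have "pdiff i (p * s) = pdiff i (r * q)" using e by simp
  then have d: "pdiff i p * s + p * pdiff i s = pdiff i r * q + r * pdiff i q"
    by (simp add: pdiff_mult)
  have "(pdiff i p * q - p * pdiff i q) * (s * s) =
    (pdiff i r * s - r * pdiff i s) * (q * q)"
    by (rule quotient_rule_cong[OF e d])
  with nz show "fractrel
     (case x of (p, q) \<Rightarrow> (pdiff i p * q - p * pdiff i q, q * q))
     (case y of (p, q) \<Rightarrow> (pdiff i p * q - p * pdiff i q, q * q))"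
    by (simp only: fractrel_iff prod.case fst_conv snd_conv \<open>x = _\<close> \<open>y = _\<close>
      mult_eq_0_iff simp_thms)
qed

lemma partial_deriv_Fract:
  "q \<noteq> 0 \<Longrightarrow> partial_deriv i (Fract p q) = Fract (pdiff i p * q - p * pdiff i q) (q * q)"
  by transfer (simp only: prod.case if_False mult_eq_0_iff simp_thms fractrel_iff fst_conv snd_conv)

section \<open>Algebraic de Rham cohomology of the moduli space\<close>

text \<open>\<open>\<MM>\<^bsub>0,n+1\<^esub>\<close> is the affine variety obtained from affine \<open>(n - 2)\<close>-space over the
  rationals by removing the zero locus of \<open>\<Prod>\<^sub>i t\<^sub>i (1 - t\<^sub>i) \<Prod>\<^bsub>i<j\<^esub> (t\<^sub>i - t\<^sub>j)\<close>.
  Its coordinate ring is the localization of the polynomial ring at this element.\<close>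

definition discr :: "nat \<Rightarrow> mpoly" where
  "discr n = (\<Prod>i\<in>{1..n-2}. pvar i * (1 - pvar i)) *
     (\<Prod>(i,j)\<in>{(i,j). 1 \<le> i \<and> i < j \<and> j \<le> n - 2}. pvar i - pvar j)"

definition regular :: "nat \<Rightarrow> ratfun set" where
  "regular n = {embed p / embed (discr n) ^ k | p k.
     \<forall>m\<in>Poly_Mapping.keys p. Poly_Mapping.keys m \<subseteq> {1..n-2}}"

text \<open>As \<open>\<MM>\<^bsub>0,n+1\<^esub>\<close> is smooth and affine, its algebraic de Rham cohomology is the
  cohomology of the complex of global algebraic differential forms. The module of \<open>p\<close>-forms
  is free over the coordinate ring on the \<open>dt\<^sub>I = dt\<^bsub>i\<^sub>1\<^esub> \<and> \<dots> \<and> dt\<^bsub>i\<^sub>p\<^esub>\<close> with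
  \<open>I = {i\<^sub>1 < \<dots> < i\<^sub>p} \<subseteq> {1..n-2}\<close>; the form \<open>g dt\<^sub>I\<close> is encoded as \<open>Poly_Mapping.single I g\<close>.\<close>

type_synonym form = "nat set \<Rightarrow>\<^sub>0 ratfun"

definition forms :: "nat \<Rightarrow> nat \<Rightarrow> form set" where
  "forms n p = {\<omega>. \<forall>I\<in>Poly_Mapping.keys \<omega>. 
     I \<subseteq> {1..n-2} \<and> card I = p \<and> Poly_Mapping.lookup \<omega> I \<in> regular n}"

text \<open>\<open>d (g dt\<^sub>I) = \<Sum>\<^sub>j (\<partial>g/\<partial>t\<^sub>j) dt\<^sub>j \<and> dt\<^sub>I\<close>; the sign sorts \<open>dt\<^sub>j \<and> dt\<^sub>I\<close> increasingly.\<close>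

definition ext_d :: "nat \<Rightarrow> form \<Rightarrow> form" where
  "ext_d n \<omega> = (\<Sum>I\<in>Poly_Mapping.keys \<omega>. \<Sum>j\<in>{1..n-2} - I.
     Poly_Mapping.single (insert j I)
       ((-1) ^ card {i\<in>I. i < j} * partial_deriv j (Poly_Mapping.lookup \<omega> I)))"

definition closed_forms :: "nat \<Rightarrow> nat \<Rightarrow> form set" where
  "closed_forms n p = {\<omega>\<in>forms n p. ext_d n \<omega> = 0}"

definition exact_forms :: "nat \<Rightarrow> nat \<Rightarrow> form set" where
  "exact_forms n p = (case p of 0 \<Rightarrow> {0} | Suc q \<Rightarrow> ext_d n ` forms n q)"

definition cohomologous :: "nat \<Rightarrow> nat \<Rightarrow> (form \<times> form) set" where
  "cohomologous n p =
     {(\<omega>, \<omega>'). \<omega> \<in> closed_forms n p \<and> \<omega>' \<in> closed_forms n p \<and> \<omega> - \<omega>' \<in> exact_forms n p}"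

definition deRham :: "nat \<Rightarrow> nat \<Rightarrow> form set set" where
  "deRham n p = closed_forms n p // cohomologous n p"

definition deRham_class :: "nat \<Rightarrow> nat \<Rightarrow> form \<Rightarrow> form set" where
  "deRham_class n p \<omega> = cohomologous n p `` {\<omega>}"

section \<open>The cell-form map\<close>

definition \<rho> :: "nat \<Rightarrow> nat \<Rightarrow> ratfun" where
  "\<rho> n i = (if i = 1 then 0 else if i = n then 1 else tcoord (i - 1))"

definition cell_form :: "nat \<Rightarrow> nat list \<Rightarrow> form" where
  "cell_form n w = Poly_Mapping.single {1..n-2}
     (1 / (\<Prod>k<length w - 1. \<rho> n (w ! Suc k) - \<rho> n (w ! k)))"

text \<open>The linear extension of \<open>(w, d) \<mapsto> [cell_form n w]\<close>. The linear combination is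
  formed with representatives, which is how the quotient \<^const>\<open>deRham\<close> gets its vector
  space structure; in particular \<open>deRham_class n p 0\<close> is its zero.\<close>

definition cell_map :: "nat \<Rightarrow> (label list set \<Rightarrow>\<^sub>0 rat) \<Rightarrow> form set" where
  "cell_map n x = deRham_class n (n - 2)
     (\<Sum>c\<in>Poly_Mapping.keys x.
       Poly_Mapping.map ((*) (ratconst (Poly_Mapping.lookup x c))) (cell_form n (cell_word c)))"

end

theory Submission
  imports Defs "HOL-Computational_Algebra.Polynomial"
begin

text \<open>
  Let \<open>R\<^sub>k\<close> be the coordinate ring in the variables \<open>t\<^sub>1, \<dots>, t\<^sub>k\<close>; it arises from the previous one by
  adjoining \<open>t = t\<^sub>k\<close> and the inverses of \<open>t - b\<close> for \<open>b\<close> in \<open>{0, 1, t\<^sub>1, \<dots>, t\<^bsub>k-1\<^esub>}\<close>. By partial fractions, a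
  function in \<open>R\<^sub>k\<close> is a \<open>t\<close>-derivative plus a sum of simple poles \<open>c\<^sub>b / (t - b)\<close>, and by comparing
  residues such a sum is exact iff all \<open>c\<^sub>b\<close> are exact in \<open>R\<^bsub>k-1\<^esub>\<close>. Inserting the letter \<open>t\<close> into a word
  between the neighbours \<open>a\<close> and \<open>b\<close> multiplies its cell function by \<open>1 / (t - a) - 1 / (t - b)\<close>, without the
  second term at the end of the word. This transformation between insertions and poles is
  unitriangular, so by induction on \<open>k\<close> the cell functions of the words that start with the point
  \<open>0\<close> form a basis of the top cohomology. On the other hand, cell functions add up to \<open>0\<close> over a shuffle, and
  modulo shuffles each word is a combination of words that start with the letter \<open>1\<close>.
\<close>

section \<open>Derivations and poles\<close>

text \<open>Exactness in several variables mixes all derivatives, and those by the old variables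
  move the poles: for \<open>b = t\<^sub>j\<close>, differentiating \<open>c / (t - b)\<close> by
  \<open>t\<^sub>j\<close> creates a double pole. But this double pole is itself a
  \<open>t\<close>-derivative and has no residue, so taking residues along \<open>t\<close> is
  compatible with the old derivatives. This makes the induction work both for spanning and for
  independence.

  Residues are compared algebraically: \<open>t\<close> is transcendental over the constants of its
  derivative, so a nonconstant polynomial in \<open>1 / (t - a)\<close> with constant coefficients
  is never regular at \<open>a\<close>.

  The triangular shape comes from the label \<open>d\<close>, that is from infinity, which stands at
  the end of every word: a letter in last place has a single finite neighbour, hence a single pole.

  Spanning yields surjectivity. For the kernel, an element is a shuffle part plus a combination of
  based words; its image is that of the based part, and independence in cohomology forces the
  coefficients there to vanish. This replaces a dimension count for the quotient by
  shuffles.\<close>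

locale derivation =
  fixes D :: "'a::field_char_0 \<Rightarrow> 'a"
  assumes D_add: "D (x + y) = D x + D y"
    and D_mult: "D (x * y) = D x * y + x * D y"
begin

lemma D_0 [simp]: "D 0 = 0"
  using D_add[of 0 0] by simp

lemma D_1 [simp]: "D 1 = 0"
  using D_mult[of 1 1] by simp

lemma D_minus: "D (- x) = - D x"
  using D_add[of x "- x"] by (simp add: eq_neg_iff_add_eq_0 add.commute)

lemma D_diff: "D (x - y) = D x - D y"
  using D_add[of x "- y"] by (simp add: D_minus)

lemma D_sum: "D (sum f A) = (\<Sum>a\<in>A. D (f a))"
  by (induction A rule: infinite_finite_induct) (simp_all add: D_add)

lemma D_of_nat [simp]: "D (of_nat k) = 0"
  by (induction k) (simp_all add: D_add)

lemma D_of_int [simp]: "D (of_int k) = 0"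
  by (cases k rule: int_diff_cases) (simp add: D_diff)

lemma D_inverse:
  assumes "x \<noteq> 0"
  shows "D (inverse x) = - D x / (x * x)"
proof -
  have "D x * inverse x + x * D (inverse x) = 0"
    using D_mult[of x "inverse x"] assms by simp
  then show ?thesis using assms by (simp add: field_simps eq_neg_iff_add_eq_0)
qed

lemma D_divide: "y \<noteq> 0 \<Longrightarrow> D (x / y) = (D x * y - x * D y) / (y * y)"
  using D_mult[of x "inverse y"] by (simp add: D_inverse divide_inverse) (simp add: field_simps)

lemma D_of_rat [simp]: "D (of_rat c) = 0"
proof (cases c)
  case (Fract a b)
  then show ?thesis by (simp add: of_rat_rat D_divide)
qed

lemma D_power: "D (x ^ k) = of_nat k * x ^ (k - 1) * D x"
proof (induction k)
  case (Suc k)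
  show ?case
  proof (cases k)
    case (Suc m)
    then show ?thesis using Suc.IH by (simp add: D_mult algebra_simps)
  qed (simp add: D_mult)
qed simp

text \<open>Polynomials over the field of constants of \<open>D\<close>. Constancy is a predicate on
  coefficients, so that constants, variable and poles all live in the one field
  \<open>'a\<close>.\<close>

definition const_poly :: "'a poly \<Rightarrow> bool" where
  "const_poly p \<longleftrightarrow> (\<forall>i. D (coeff p i) = 0)"

lemma const_poly_0 [simp]: "const_poly 0"
  by (simp add: const_poly_def)

lemma const_poly_pCons [simp]: "const_poly (pCons c p) \<longleftrightarrow> D c = 0 \<and> const_poly p"
  by (auto simp: const_poly_def coeff_pCons split: nat.splits)

lemma const_poly_1 [simp]: "const_poly 1"
  by (simp add: one_pCons)

lemma const_poly_add: "const_poly p \<Longrightarrow> const_poly q \<Longrightarrow> const_poly (p + q)"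
  by (simp add: const_poly_def D_add)

lemma const_poly_minus: "const_poly p \<Longrightarrow> const_poly (- p)"
  by (simp add: const_poly_def D_minus)

lemma const_poly_diff: "const_poly p \<Longrightarrow> const_poly q \<Longrightarrow> const_poly (p - q)"
  by (simp add: const_poly_def D_diff)

lemma const_poly_mult: "const_poly p \<Longrightarrow> const_poly q \<Longrightarrow> const_poly (p * q)"
  by (simp add: const_poly_def coeff_mult D_sum D_mult)

lemma const_poly_power: "const_poly p \<Longrightarrow> const_poly (p ^ k)"
  by (induction k) (simp_all add: const_poly_mult)

lemma const_poly_pderiv: "const_poly p \<Longrightarrow> const_poly (pderiv p)"
  by (auto simp: const_poly_def coeff_pderiv D_mult D_add)

lemma const_poly_pcompose: "const_poly p \<Longrightarrow> const_poly q \<Longrightarrow> const_poly (pcompose p q)"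
  by (induction p) (auto simp: pcompose_pCons const_poly_add const_poly_mult)

lemma const_poly_reflect: "const_poly p \<Longrightarrow> const_poly (reflect_poly p)"
  by (simp add: const_poly_def coeff_reflect_poly)

lemma D_poly: "const_poly p \<Longrightarrow> D (poly p x) = poly (pderiv p) x * D x"
  by (induction p) (auto simp: pderiv_pCons D_add D_mult algebra_simps)

end

section \<open>A variable transcendental over the constants, and regularity at a point\<close>

locale derivation_var = derivation +
  fixes t :: 'a
  assumes D_t: "D t = 1"
begin

text \<open>As \<open>D t = 1\<close>, differentiating \<open>poly p t = 0\<close> gives a relation
  \<open>poly (pderiv p) t = 0\<close> of smaller degree. By induction \<open>pderiv p = 0\<close>,
  so in characteristic 0 the polynomial is a constant, which the relation makes
  \<open>0\<close>.\<close>

lemma transcendental: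
  assumes "const_poly p" "poly p t = 0"
  shows "p = 0"
  using assms
proof (induction "degree p" arbitrary: p rule: less_induct)
  case less
  have "poly (pderiv p) t = 0"
    using D_poly[of p t] less.prems by (simp add: D_t)
  moreover have "const_poly (pderiv p)" using less.prems by (simp add: const_poly_pderiv)
  ultimately have "pderiv p = 0" if "degree p \<noteq> 0"
    using less.hyps that by (simp add: degree_pderiv)
  then have "degree p = 0" by (metis pderiv_eq_0_iff)
  then obtain c where "p = [:c:]" by (metis degree_eq_zeroE)
  then show ?case using less.prems by simp
qed

corollary poly_t_inject:
  assumes "const_poly p" "const_poly q" "poly p t = poly q t"
  shows "p = q"
  using transcendental[of "p - q"] assms by (simp add: const_poly_diff)

lemma t_neq_const: "D b = 0 \<Longrightarrow> t \<noteq> b"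
  using D_t by auto

text \<open>For a constant \<open>a\<close> this is the localization of \<open>K[t]\<close> at
  \<open>t - a\<close>, with \<open>K\<close> the constants of \<open>D\<close>: the rational
  functions in \<open>t\<close> without pole at \<open>a\<close>.\<close>

definition local_ring :: "'a \<Rightarrow> 'a set" where
  "local_ring a = {poly p t / poly q t | p q. const_poly p \<and> const_poly q \<and> poly q a \<noteq> 0}"

lemma local_ringI:
  "const_poly p \<Longrightarrow> const_poly q \<Longrightarrow> poly q a \<noteq> 0 \<Longrightarrow> x = poly p t / poly q t \<Longrightarrow> x \<in> local_ring a"
  unfolding local_ring_def by blast

lemma poly_t_neq_0: "const_poly q \<Longrightarrow> poly q a \<noteq> 0 \<Longrightarrow> poly q t \<noteq> 0"
  using transcendental by force

lemma local_ring_add: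
  assumes "x \<in> local_ring a" "y \<in> local_ring a"
  shows "x + y \<in> local_ring a"
proof -
  from assms obtain p q r s where c: "const_poly p" "const_poly q" "const_poly r" "const_poly s"
    "poly q a \<noteq> 0" "poly s a \<noteq> 0" and e: "x = poly p t / poly q t" "y = poly r t / poly s t"
    unfolding local_ring_def by blast
  have "x + y = poly (p * s + r * q) t / poly (q * s) t"
    using poly_t_neq_0[OF c(2,5)] poly_t_neq_0[OF c(4,6)] by (simp add: e field_simps)
  then show ?thesis using c
    by (intro local_ringI[of "p * s + r * q" "q * s"]) (auto intro!: const_poly_add const_poly_mult)
qed

lemma local_ring_poly: "const_poly p \<Longrightarrow> poly p t \<in> local_ring a"
  by (rule local_ringI[of _ 1]) auto

lemma local_ring_sum: "(\<And>i. i \<in> I \<Longrightarrow> f i \<in> local_ring a) \<Longrightarrow> sum f I \<in> local_ring a"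
  using local_ring_poly[of 0]
  by (induction I rule: infinite_finite_induct) (auto intro: local_ring_add)

lemma local_ring_minus: "x \<in> local_ring a \<Longrightarrow> - x \<in> local_ring a"
  by (auto simp: local_ring_def) (metis const_poly_minus poly_minus minus_divide_left)

lemma local_ring_D:
  assumes "x \<in> local_ring a"
  shows "D x \<in> local_ring a"
proof -
  from assms obtain p q where c: "const_poly p" "const_poly q" "poly q a \<noteq> 0"
    and e: "x = poly p t / poly q t"
    unfolding local_ring_def by blast
  have "D x = poly (pderiv p * q - p * pderiv q) t / poly (q * q) t"
    using poly_t_neq_0[OF c(2,3)] c by (simp add: e D_divide D_poly D_t)
  then show ?thesis using c
    by (intro local_ringI[of "pderiv p * q - p * pderiv q" "q * q"])
      (auto intro!: const_poly_diff const_poly_mult const_poly_pderiv)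
qed

lemma local_ring_pole:
  assumes "D c = 0" "D b = 0" "b \<noteq> a"
  shows "c / (t - b) ^ k \<in> local_ring a"
  by (rule local_ringI[of "[:c:]" "[:- b, 1:] ^ k"]) (use assms in \<open>auto simp: D_minus intro!: const_poly_power\<close>)

text \<open>Multiplying by \<open>(t - a) ^ degree Q\<close> and by the denominator gives a relation
  between polynomials in \<open>t\<close>. By transcendence it is a polynomial identity and may be
  evaluated at \<open>a\<close>, where the reversed polynomial contributes
  \<open>lead_coeff Q\<close>. Positive degree would force
  \<open>lead_coeff Q * poly q a = 0\<close>.\<close>

lemma no_pole_in_local_ring:
  assumes Q: "const_poly Q" and a: "D a = 0" and mem: "poly Q (1 / (t - a)) \<in> local_ring a"
  shows "degree Q = 0"
proof (rule ccontr)
  let ?d = "degree Q"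
  assume d: "?d \<noteq> 0"
  from mem obtain p q where c: "const_poly p" "const_poly q" "poly q a \<noteq> 0"
    and e: "poly Q (1 / (t - a)) = poly p t / poly q t"
    unfolding local_ring_def by blast
  have ta: "t - a \<noteq> 0" using t_neq_const[OF a] by simp
  let ?X = "[:- a, 1:]"
  let ?R = "pcompose (reflect_poly Q) ?X"
  have cX: "const_poly ?X" using a by (simp add: D_minus)
  have "poly ?R t = (t - a) ^ ?d * poly Q (1 / (t - a))"
    using poly_reflect_poly_nz[OF ta, of Q] by (simp add: poly_pcompose inverse_eq_divide)
  then have "poly (?R * q) t = poly (?X ^ ?d * p) t"
    using poly_t_neq_0[OF c(2,3)] by (simp add: e)
  then have "?R * q = ?X ^ ?d * p"
    using Q c cX by (intro poly_t_inject) (auto intro!: const_poly_mult const_poly_power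
      const_poly_pcompose const_poly_reflect)
  then have "poly (?R * q) a = poly (?X ^ ?d * p) a" by simp
  then have "lead_coeff Q * poly q a = 0"
    using d by (simp add: poly_pcompose poly_0_coeff_0 coeff_0_reflect_poly)
  then show False using c(3) d by auto
qed

end

section \<open>Adjoining a variable with poles, and partial fractions\<close>

inductive_set adjoin :: "'a::field set \<Rightarrow> 'a set \<Rightarrow> 'a \<Rightarrow> 'a set"
  for R B :: "'a set" and t :: 'a where
  base: "c \<in> R \<Longrightarrow> c \<in> adjoin R B t"
| add: "x \<in> adjoin R B t \<Longrightarrow> y \<in> adjoin R B t \<Longrightarrow> x + y \<in> adjoin R B t"
| var: "x \<in> adjoin R B t \<Longrightarrow> t * x \<in> adjoin R B t"
| pole: "x \<in> adjoin R B t \<Longrightarrow> b \<in> B \<Longrightarrow> x / (t - b) \<in> adjoin R B t"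

definition rat_subalgebra :: "'a::field_char_0 set \<Rightarrow> bool" where
  "rat_subalgebra R \<longleftrightarrow> range of_rat \<subseteq> R \<and> (\<forall>x\<in>R. \<forall>y\<in>R. x + y \<in> R \<and> x * y \<in> R)"

context
  fixes R :: "'a::field_char_0 set"
  assumes R: "rat_subalgebra R"
begin

lemma subalg_of_rat: "of_rat c \<in> R"
  using R by (auto simp: rat_subalgebra_def)

lemma subalg_add: "x \<in> R \<Longrightarrow> y \<in> R \<Longrightarrow> x + y \<in> R"
  using R by (auto simp: rat_subalgebra_def)

lemma subalg_mult: "x \<in> R \<Longrightarrow> y \<in> R \<Longrightarrow> x * y \<in> R"
  using R by (auto simp: rat_subalgebra_def)

lemma subalg_0: "0 \<in> R"
  using subalg_of_rat[of 0] by simp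

lemma subalg_1: "1 \<in> R"
  using subalg_of_rat[of 1] by simp

lemma subalg_minus: "x \<in> R \<Longrightarrow> - x \<in> R"
  using subalg_mult[of "of_rat (-1)" x] subalg_of_rat[of "-1"] by simp

lemma subalg_diff: "x \<in> R \<Longrightarrow> y \<in> R \<Longrightarrow> x - y \<in> R"
  using subalg_add[of x "- y"] subalg_minus by simp

lemma subalg_sum: "(\<And>i. i \<in> I \<Longrightarrow> f i \<in> R) \<Longrightarrow> sum f I \<in> R"
  by (induction I rule: infinite_finite_induct) (auto intro: subalg_add subalg_0)

lemma subalg_prod: "(\<And>i. i \<in> I \<Longrightarrow> f i \<in> R) \<Longrightarrow> prod f I \<in> R"
  by (induction I rule: infinite_finite_induct) (auto intro: subalg_mult subalg_1)

lemma subalg_power: "x \<in> R \<Longrightarrow> x ^ k \<in> R"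
  by (induction k) (auto intro: subalg_mult subalg_1)

lemma adjoin_scale: "c \<in> R \<Longrightarrow> x \<in> adjoin R B t \<Longrightarrow> c * x \<in> adjoin R B t"
proof (rotate_tac, induction rule: adjoin.induct)
  case (pole x b)
  then have "c * x / (t - b) \<in> adjoin R B t" by (intro adjoin.pole)
  then show ?case by simp
qed (auto simp: distrib_left mult.left_commute[of c] intro: adjoin.intros subalg_mult)

text \<open>The rules of \<open>adjoin\<close> multiply by one generator at a time, which keeps
  inductions over it short; products are recovered by induction on one factor.\<close>

lemma adjoin_mult: "x \<in> adjoin R B t \<Longrightarrow> y \<in> adjoin R B t \<Longrightarrow> x * y \<in> adjoin R B t"
  by (induction rule: adjoin.induct)
    (auto simp: distrib_right mult.assoc times_divide_eq_left intro: adjoin_scale adjoin.intros)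

lemma rat_subalgebra_adjoin: "rat_subalgebra (adjoin R B t)"
  unfolding rat_subalgebra_def by (auto intro: adjoin.intros adjoin_mult subalg_of_rat)

end

inductive_set partial_fractions :: "'a::field set \<Rightarrow> 'a set \<Rightarrow> 'a \<Rightarrow> 'a set"
  for R B :: "'a set" and t :: 'a where
  monom: "c \<in> R \<Longrightarrow> c * t ^ k \<in> partial_fractions R B t"
| pole: "c \<in> R \<Longrightarrow> b \<in> B \<Longrightarrow> c / (t - b) ^ k \<in> partial_fractions R B t"
| add: "x \<in> partial_fractions R B t \<Longrightarrow> y \<in> partial_fractions R B t \<Longrightarrow>
    x + y \<in> partial_fractions R B t"

context
  fixes R B :: "'a::field_char_0 set" and t :: 'a
  assumes R: "rat_subalgebra R" and BR: "B \<subseteq> R"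
    and units: "\<And>a b. a \<in> B \<Longrightarrow> b \<in> B \<Longrightarrow> a \<noteq> b \<Longrightarrow> inverse (a - b) \<in> R"
    and tB: "t \<notin> B"
begin

lemma partial_fractions_var: "x \<in> partial_fractions R B t \<Longrightarrow> t * x \<in> partial_fractions R B t"
proof (induction rule: partial_fractions.induct)
  case (monom c k)
  then have "c * t ^ Suc k \<in> partial_fractions R B t" by (rule partial_fractions.monom)
  then show ?case by (simp add: mult_ac)
next
  case (pole c b k)
  show ?case
  proof (cases k)
    case 0
    then show ?thesis using partial_fractions.monom[OF pole(1), of t 1] by (simp add: mult_ac)
  next
    case (Suc m)
    have tb: "t - b \<noteq> 0" using tB pole by auto
    have "t * (c / (t - b) ^ k) = c / (t - b) ^ m + (b * c) / (t - b) ^ Suc m"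
      using tb by (simp add: Suc field_simps)
    moreover have "b * c \<in> R" using pole BR by (auto intro: subalg_mult[OF R])
    ultimately show ?thesis using pole by (auto intro!: partial_fractions.intros simp del: power_Suc)
  qed
next
  case (add x y)
  then show ?case by (simp add: distrib_left partial_fractions.add)
qed

text \<open>Powers of \<open>t\<close> are lowered by \<open>t = (t - b) + b\<close>. For distinct
  poles, \<open>1 / ((t - a) * (t - b))\<close> is \<open>1 / (t - a) - 1 / (t - b)\<close> divided
  by \<open>a - b\<close>, which lowers the power of \<open>t - a\<close>; here differences of poles
  have to be units of \<open>R\<close>.\<close>

lemma partial_fractions_pole:
  "x \<in> partial_fractions R B t \<Longrightarrow> b \<in> B \<Longrightarrow> x / (t - b) \<in> partial_fractions R B t"
proof (induction rule: partial_fractions.induct)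
  case (monom c k)
  have tb: "t - b \<noteq> 0" using tB monom by auto
  show ?case
  using monom(1) proof (induction k arbitrary: c)
    case 0
    then show ?case using partial_fractions.pole[OF 0 monom(2), of t 1] by simp
  next
    case (Suc k)
    have "c * t ^ Suc k / (t - b) = c * t ^ k + (b * c) * t ^ k / (t - b)"
      using tb by (simp add: field_simps)
    moreover have "b * c \<in> R" using Suc monom BR by (auto intro: subalg_mult[OF R])
    ultimately show ?case using Suc by (auto intro!: partial_fractions.intros simp del: power_Suc)
  qed
next
  case (pole c a k)
  have tb: "t - b \<noteq> 0" "t - a \<noteq> 0" using tB pole by auto
  show ?case
  proof (cases "a = b")
    case True
    then show ?thesis using partial_fractions.pole[OF pole(1,2), of t "Suc k"] by (simp add: mult_ac)
  next
    case False
    show ?thesis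
    using pole(1) proof (induction k arbitrary: c)
      case 0
      then show ?case using partial_fractions.pole[OF 0 pole(3), of t 1] by simp
    next
      case (Suc k)
      have ab: "a - b \<noteq> 0" using False by simp
      have 1: "1 / ((t - a) * (t - b)) = inverse (a - b) * (1 / (t - a)) + - inverse (a - b) * (1 / (t - b))"
        using tb ab by (simp add: divide_simps)
      have "c / (t - a) ^ Suc k / (t - b) = c / (t - a) ^ k * (1 / ((t - a) * (t - b)))"
        by simp
      also have "\<dots> = (c * inverse (a - b)) / (t - a) ^ Suc k
          + (c * - inverse (a - b)) / (t - a) ^ k / (t - b)"
        unfolding 1 by (simp add: divide_inverse right_diff_distrib mult_ac)
      finally have eq: "c / (t - a) ^ Suc k / (t - b) = \<dots>" .
      have "inverse (a - b) \<in> R" using pole(2,3) False units by auto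
      then have "c * inverse (a - b) \<in> R" "c * - inverse (a - b) \<in> R"
        using Suc.prems by (auto intro!: subalg_mult[OF R] subalg_minus[OF R] simp del: mult_minus_right)
      then show ?case unfolding eq
        using Suc.IH pole(2) by (intro partial_fractions.add partial_fractions.pole)
    qed
  qed
next
  case (add x y)
  then show ?case by (simp add: add_divide_distrib partial_fractions.add)
qed

lemma adjoin_partial_fractions: "x \<in> adjoin R B t \<Longrightarrow> x \<in> partial_fractions R B t"
proof (induction rule: adjoin.induct)
  case (base c)
  then show ?case using partial_fractions.monom[OF base, of t 0] by simp
qed (auto intro: partial_fractions.add partial_fractions_var partial_fractions_pole)

end

section \<open>Primitives and residues in one variable\<close>

locale pole_extension = derivation_var +
  fixes R B :: "'a set"
  assumes subalg: "rat_subalgebra R" and BR: "B \<subseteq> R" and finite_B: "finite B"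
    and units: "\<And>a b. a \<in> B \<Longrightarrow> b \<in> B \<Longrightarrow> a \<noteq> b \<Longrightarrow> inverse (a - b) \<in> R"
    and R_const: "\<And>c. c \<in> R \<Longrightarrow> D c = 0"
begin

lemma t_notin_B: "t \<notin> B"
  using t_neq_const R_const BR by blast

lemma t_minus_neq_0: "b \<in> B \<Longrightarrow> t - b \<noteq> 0"
  using t_notin_B by auto

lemma partial_fraction: "x \<in> adjoin R B t \<Longrightarrow> x \<in> partial_fractions R B t"
  by (rule adjoin_partial_fractions[OF subalg BR _ t_notin_B]) (auto intro: units)

lemma adjoin_pole_power:
  assumes "c \<in> R" "b \<in> B"
  shows "c / (t - b) ^ k \<in> adjoin R B t"
proof (induction k)
  case (Suc k)
  then show ?case using adjoin.pole[OF Suc assms(2)] by (simp add: mult_ac)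
qed (use assms in \<open>auto intro: adjoin.base\<close>)

lemma adjoin_power: "t ^ k \<in> adjoin R B t"
  by (induction k) (auto intro: adjoin.intros subalg_1[OF subalg])

text \<open>Integrate the partial fractions term by term. Since \<open>R\<close> contains the
  rationals, powers of \<open>t\<close> and poles of order at least 2 have primitives inside the
  ring; the simple poles remain.\<close>

lemma decompose:
  assumes "g \<in> adjoin R B t"
  shows "\<exists>h\<in>adjoin R B t. \<exists>c. (\<forall>b\<in>B. c b \<in> R) \<and> g = D h + (\<Sum>b\<in>B. c b / (t - b))"
  using partial_fraction[OF assms]
proof (induction rule: partial_fractions.induct)
  case (monom c k)
  \<comment> \<open>The factor \<open>1 / (k + 1)\<close> of the primitive, written through
    \<open>of_rat\<close> so that it lies in \<open>R\<close> and is killed by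
    \<open>D\<close>.\<close>
  define e :: 'a where "e = of_rat (1 / of_nat (Suc k))"
  let ?h = "c * e * t ^ Suc k"
  have "e * of_nat (Suc k) = of_rat (1 / of_nat (Suc k) * of_nat (Suc k))"
    unfolding e_def of_rat_mult of_rat_of_nat_eq ..
  then have e: "e * of_nat (Suc k) = 1" by (simp del: of_nat_Suc)
  have "D e = 0" by (simp add: e_def)
  then have "D ?h = c * (e * of_nat (Suc k)) * t ^ k"
    by (simp only: D_mult D_power D_t R_const[OF monom] diff_Suc_1) (simp add: algebra_simps)
  then have "D ?h = c * t ^ k" unfolding e by simp
  then have "c * t ^ k = D ?h + (\<Sum>b\<in>B. 0 / (t - b))" by simp
  moreover have "?h \<in> adjoin R B t"
    using monom unfolding e_def by (intro adjoin_scale[OF subalg] subalg_mult[OF subalg] subalg_of_rat[OF subalg] adjoin_power)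
  moreover have "0 \<in> R" by (rule subalg_0[OF subalg])
  ultimately show ?case by (intro bexI[of _ ?h] exI[of _ "\<lambda>_. 0"]) simp_all
next
  case (pole c b k)
  note 0 = subalg_0[OF subalg]
  have tb: "t - b \<noteq> 0" using t_minus_neq_0 pole by simp
  have Db: "D (t - b) = 1" using pole BR R_const by (auto simp: D_diff D_t)
  consider "k = 0" | "k = 1" | m where "k = Suc (Suc m)" by (metis One_nat_def not0_implies_Suc)
  then show ?case
  proof cases
    case 1
    have "c = D (c * t) + (\<Sum>b\<in>B. 0 / (t - b))"
      by (simp add: D_mult D_t R_const[OF pole(1)])
    moreover have "c * t \<in> adjoin R B t"
      using adjoin_scale[OF subalg pole(1) adjoin_power[of 1]] by simp
    ultimately show ?thesis using 0 1 by (intro bexI[of _ "c * t"] exI[of _ "\<lambda>_. 0"]) auto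
  next
    case 2
    have "(\<Sum>a\<in>B. (if a = b then c else 0) / (t - a)) = (\<Sum>a\<in>B. if a = b then c / (t - a) else 0)"
      by (intro sum.cong) auto
    also have "\<dots> = c / (t - b)" using pole finite_B by simp
    finally have "c / (t - b) ^ k = D 0 + (\<Sum>a\<in>B. (if a = b then c else 0) / (t - a))"
      using 2 by simp
    moreover have "0 \<in> adjoin R B t" using 0 by (rule adjoin.base)
    ultimately show ?thesis using pole(1) 0
      by (intro bexI[of _ 0] exI[of _ "\<lambda>a. if a = b then c else 0"]) auto
  next
    case 3
    let ?h = "(c * of_rat (- (1 / of_nat (Suc m)))) / (t - b) ^ Suc m"
    have n: "of_nat (Suc m) \<noteq> (0::'a)" by (rule of_nat_neq_0)
    have "D ?h = (c * (1 / of_nat (Suc m))) * (of_nat (Suc m) * (t - b) ^ m) / ((t - b) ^ Suc m * (t - b) ^ Suc m)"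
      using tb by (simp add: D_divide D_mult D_power Db R_const[OF pole(1)] D_minus of_rat_minus of_rat_divide
        del: power_Suc of_nat_Suc)
    also have "\<dots> = c / (t - b) ^ k"
      using n tb by (simp add: 3 divide_simps del: of_nat_Suc)
    finally have "c / (t - b) ^ k = D ?h + (\<Sum>b\<in>B. 0 / (t - b))" by simp
    moreover have "?h \<in> adjoin R B t"
      using pole by (intro adjoin_pole_power subalg_mult[OF subalg] subalg_of_rat[OF subalg])
    ultimately show ?thesis using 0 by (intro bexI[of _ ?h] exI[of _ "\<lambda>_. 0"]) auto
  qed
next
  case (add x y)
  then obtain h c h' c' where "h \<in> adjoin R B t" "h' \<in> adjoin R B t"
    "\<forall>b\<in>B. c b \<in> R" "\<forall>b\<in>B. c' b \<in> R"
    "x = D h + (\<Sum>b\<in>B. c b / (t - b))" "y = D h' + (\<Sum>b\<in>B. c' b / (t - b))" by blast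
  then show ?case
    by (intro bexI[of _ "h + h'"] exI[of _ "\<lambda>b. c b + c' b"])
      (auto simp: D_add add_divide_distrib sum.distrib intro: adjoin.add subalg_add[OF subalg])
qed

text \<open>In a partial fraction, the terms with a pole at \<open>a\<close> are monomials in
  \<open>1 / (t - a)\<close> with constant coefficients, and all others are regular at
  \<open>a\<close>.\<close>

lemma principal_part:
  assumes "h \<in> adjoin R B t" "a \<in> B"
  shows "\<exists>P. const_poly P \<and> h - poly P (1 / (t - a)) \<in> local_ring a"
  using partial_fraction[OF assms(1)]
proof (induction rule: partial_fractions.induct)
  case (monom c k)
  have "poly ([:c:] * [:0, 1:] ^ k) t \<in> local_ring a"
    using R_const[OF monom] by (intro local_ring_poly const_poly_mult const_poly_power) auto
  then show ?case by (intro exI[of _ 0]) auto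
next
  case (pole c b k)
  have c: "D c = 0" "D b = 0" using pole R_const BR by auto
  show ?case
  proof (cases "b = a")
    case True
    have "poly ([:c:] * [:0, 1:] ^ k) (1 / (t - a)) = c / (t - b) ^ k"
      by (simp add: True power_one_over)
    moreover have "const_poly ([:c:] * [:0, 1:] ^ k)"
      using c by (intro const_poly_mult const_poly_power) auto
    moreover have "0 \<in> local_ring a" using local_ring_poly[of 0] by simp
    ultimately show ?thesis by (metis cancel_comm_monoid_add_class.diff_cancel)
  next
    case False
    then show ?thesis using local_ring_pole c by (intro exI[of _ 0]) auto
  qed
next
  case (add x y)
  then obtain P Q where "const_poly P" "const_poly Q" "x - poly P (1 / (t - a)) \<in> local_ring a"
    "y - poly Q (1 / (t - a)) \<in> local_ring a" by blast
  then show ?case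
    using local_ring_add[of "x - poly P (1 / (t - a))" a "y - poly Q (1 / (t - a))"]
    by (intro exI[of _ "P + Q"]) (auto simp: const_poly_add add_diff_add)
qed

text \<open>The principal part of \<open>D h\<close> at \<open>a\<close> is
  \<open>- y\<^sup>2 P' y\<close> with \<open>y = 1 / (t - a)\<close>, which has no linear term in \<open>y\<close>.\<close>

lemma residue_of_derivative:
  assumes h: "h \<in> adjoin R B t" and c: "\<And>b. b \<in> B \<Longrightarrow> c b \<in> R"
    and eq: "(\<Sum>b\<in>B. c b / (t - b)) = D h" and a: "a \<in> B"
  shows "c a = 0"
proof -
  let ?y = "1 / (t - a)"
  have Da: "D a = 0" using a BR R_const by auto
  have ta: "t - a \<noteq> 0" using t_minus_neq_0 a by simp
  obtain P where P: "const_poly P" "h - poly P ?y \<in> local_ring a"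
    using principal_part[OF h a] by blast
  have Dy: "D ?y = - ?y * ?y" using ta by (simp add: D_divide D_diff D_t Da)
  have 1: "D h - poly (pderiv P) ?y * D ?y \<in> local_ring a"
    using local_ring_D[OF P(2)] P(1) by (simp add: D_diff D_poly)
  have "(\<Sum>b\<in>B - {a}. c b / (t - b)) \<in> local_ring a"
  proof (rule local_ring_sum)
    fix b assume "b \<in> B - {a}"
    then show "c b / (t - b) \<in> local_ring a"
      using local_ring_pole[of "c b" b a 1] c BR R_const by auto
  qed
  moreover have "(\<Sum>b\<in>B. c b / (t - b)) = c a / (t - a) + (\<Sum>b\<in>B - {a}. c b / (t - b))"
    using finite_B a by (rule sum.remove)
  ultimately have 2: "D h - c a / (t - a) \<in> local_ring a" using eq by simp
  \<comment> \<open>At \<open>y = 1 / (t - a)\<close> this is \<open>c a * y + y ^ 2 * P' y\<close>,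
    the simple pole minus the principal part of \<open>D h\<close>. It is regular at
    \<open>a\<close>, so \<open>?Q\<close> is constant; its linear coefficient is
    \<open>c a\<close>.\<close>
  let ?Q = "[:0, c a:] + [:0, 0, 1:] * pderiv P"
  have "poly ?Q ?y = (D h - poly (pderiv P) ?y * D ?y) + - (D h - c a / (t - a))"
    by (simp add: Dy algebra_simps)
  also have "\<dots> \<in> local_ring a" using 1 2 by (intro local_ring_add local_ring_minus)
  finally have "poly ?Q ?y \<in> local_ring a" .
  moreover have "const_poly ?Q"
    using P c[OF a] R_const by (intro const_poly_add const_poly_mult const_poly_pderiv) auto
  ultimately have "degree ?Q = 0" using no_pole_in_local_ring Da by blast
  then have "coeff ?Q 1 = 0" by (intro coeff_eq_0) simp
  then show ?thesis by (simp add: coeff_mult)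
qed

end

section \<open>The coordinate rings and their exact forms\<close>

instance fract :: ("{idom, ring_char_0}") field_char_0
  by standard (auto intro!: injI simp: of_nat_fract eq_fract)

lemma ratconst_add: "ratconst (a + b) = ratconst a + ratconst b"
  by (simp add: ratconst_def single_add)

lemma ratconst_mult: "ratconst (a * b) = ratconst a * ratconst b"
  by (simp add: ratconst_def mult_single)

lemma ratconst_of_nat: "ratconst (of_nat k) = of_nat k"
  by (induction k) (simp_all add: ratconst_add, simp_all add: ratconst_def fract_collapse)

lemma ratconst_eq_of_rat: "ratconst c = of_rat c"
proof (cases c)
  case (Fract a b)
  have of_int: "ratconst (of_int k) = of_int k" for k
  proof (cases k rule: int_diff_cases)
    case (diff m n)
    have "ratconst (of_int k) + ratconst (of_nat n) = ratconst (of_nat m)"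
      by (simp add: diff flip: ratconst_add)
    then show ?thesis by (simp add: ratconst_of_nat diff eq_diff_eq)
  qed
  have "c * of_int b = of_int a" using Fract by (simp add: Fract_of_int_quotient)
  then have "ratconst c * of_int b = of_int a" by (metis of_int ratconst_mult)
  then show ?thesis using Fract by (simp add: of_rat_rat nonzero_eq_divide_eq)
qed

text \<open>What additivity of the quotient rule becomes after cross-multiplication. The derivatives
  are independent variables of an arbitrary domain, so that the simplifier normalizes letters
  instead of multivariate polynomials; likewise for the product below.\<close>

lemma quotient_rule_add:
  fixes a b c d a' b' c' d' :: "'a::idom"
  shows "((a' * d + a * d' + (c' * b + c * b')) * (b * d) - (a * d + c * b) * (b' * d + b * d')) * (b * b * (d * d))
    = ((a' * b - a * b') * (d * d) + (c' * d - c * d') * (b * b)) * (b * d * (b * d))"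
  by (simp add: algebra_simps)

lemma quotient_rule_mult:
  fixes a b c d a' b' c' d' :: "'a::idom"
  shows "((a' * c + a * c') * (b * d) - a * c * (b' * d + b * d')) * (b * b * d * (b * (d * d)))
    = ((a' * b - a * b') * c * (b * (d * d)) + a * (c' * d - c * d') * (b * b * d)) * (b * d * (b * d))"
  by (simp add: algebra_simps)

global_interpretation pd: derivation "partial_deriv i"
proof
  fix x y :: ratfun
  obtain a b where x: "x = Fract a b" "b \<noteq> 0" by (cases x rule: Fract_cases) auto
  obtain c d where y: "y = Fract c d" "d \<noteq> 0" by (cases y rule: Fract_cases) auto
  have bd: "b * d \<noteq> 0" "b * b \<noteq> 0" "d * d \<noteq> 0" "b * d * (b * d) \<noteq> 0" "b * b * (d * d) \<noteq> 0"
    "b * b * d \<noteq> 0" "b * (d * d) \<noteq> 0" "b * b * d * (b * (d * d)) \<noteq> 0"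
    using x y by auto
  show "partial_deriv i (x + y) = partial_deriv i x + partial_deriv i y"
    unfolding x(1) y(1) add_fract[OF x(2) y(2)] partial_deriv_Fract[OF x(2)] partial_deriv_Fract[OF y(2)]
      partial_deriv_Fract[OF bd(1)] add_fract[OF bd(2,3)] eq_fract(1)[OF bd(4,5)] pdiff_add pdiff_mult
    by (rule quotient_rule_add)
  show "partial_deriv i (x * y) = partial_deriv i x * y + x * partial_deriv i y"
    unfolding x(1) y(1) mult_fract partial_deriv_Fract[OF x(2)] partial_deriv_Fract[OF y(2)]
      partial_deriv_Fract[OF bd(1)] add_fract[OF bd(6,7)] eq_fract(1)[OF bd(4,8)] pdiff_mult
    by (rule quotient_rule_mult)
qed

lemma pdiff_commute: "pdiff i (pdiff j p) = pdiff j (pdiff i p)"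
proof (induction p rule: mpoly_induct)
  case (add m c q)
  have "pdiff i (pdiff j (Poly_Mapping.single m c)) = pdiff j (pdiff i (Poly_Mapping.single m c))"
    by (cases "i = j")
      (simp_all add: pdiff_single diff_diff_eq add.commute lookup_minus lookup_single mult_ac)
  with add show ?case by (simp add: pdiff_add)
qed simp

lemma pdiff_1 [simp]: "pdiff i 1 = 0"
  using pdiff_mult[of i 1 1] by simp

lemma partial_deriv_embed: "partial_deriv i (embed p) = embed (pdiff i p)"
  by (simp add: partial_deriv_Fract)

text \<open>For \<open>x = p / q\<close>, compare the mixed derivatives of \<open>p = x * q\<close>.
  They agree on \<open>p\<close> and on \<open>q\<close>, and the Leibniz cross terms are symmetric
  in \<open>i\<close> and \<open>j\<close>, so only the mixed derivatives of \<open>x\<close>, times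
  \<open>q\<close>, are left.\<close>

lemma partial_deriv_commute: "partial_deriv i (partial_deriv j x) = partial_deriv j (partial_deriv i x)"
proof -
  obtain p q where x: "x = Fract p q" "q \<noteq> 0" by (cases x rule: Fract_cases) auto
  have q: "embed q \<noteq> 0" using x by (simp add: Zero_fract_def eq_fract)
  have e: "embed p = x * embed q" using x(2) by (simp add: x(1) eq_fract)
  have "partial_deriv i (partial_deriv j (embed p)) = partial_deriv j (partial_deriv i (embed p))"
    "partial_deriv i (partial_deriv j (embed q)) = partial_deriv j (partial_deriv i (embed q))"
    by (simp_all add: partial_deriv_embed pdiff_commute)
  then have "partial_deriv i (partial_deriv j x) * embed q = partial_deriv j (partial_deriv i x) * embed q"
    unfolding e by (simp add: pd.D_mult pd.D_add algebra_simps)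
  then show ?thesis using q by simp
qed

lemma partial_deriv_tcoord: "partial_deriv i (tcoord j) = (if i = j then 1 else 0)"
  by (auto simp: tcoord_def partial_deriv_embed pvar_def pdiff_single lookup_single fract_collapse
      single_one)

section \<open>The tower of coordinate rings\<close>

definition points :: "nat \<Rightarrow> ratfun set" where
  "points k = {0, 1} \<union> tcoord ` {1..k}"

text \<open>The algebraic form of the fibrations that forget the last moving point: the fibre is the
  affine line without \<open>points k\<close>. Agreement with the single localization
  \<open>regular\<close> is shown below.\<close>

primrec coord_ring :: "nat \<Rightarrow> ratfun set" where
  "coord_ring 0 = range of_rat"
| "coord_ring (Suc k) = adjoin (coord_ring k) (points k) (tcoord (Suc k))"

declare coord_ring.simps(2) [simp del]

lemma finite_points: "finite (points k)"
  by (simp add: points_def)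

lemma points_Suc: "points (Suc k) = insert (tcoord (Suc k)) (points k)"
  by (auto simp: points_def atLeastAtMostSuc_conv)

lemma coord_ring_subalg: "rat_subalgebra (coord_ring k)"
proof (induction k)
  case 0
  have "of_rat a + of_rat b \<in> range (of_rat :: _ \<Rightarrow> ratfun)"
    "of_rat a * of_rat b \<in> range (of_rat :: _ \<Rightarrow> ratfun)" for a b
    by (metis rangeI of_rat_add, metis rangeI of_rat_mult)
  then show ?case by (auto simp: rat_subalgebra_def)
qed (simp add: coord_ring.simps rat_subalgebra_adjoin)

lemma coord_ring_Suc: "c \<in> coord_ring k \<Longrightarrow> c \<in> coord_ring (Suc k)"
  by (simp add: coord_ring.simps adjoin.base)

lemma tcoord_in_coord_ring: "tcoord (Suc k) \<in> coord_ring (Suc k)"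
  using adjoin.var[OF adjoin.base[OF subalg_1[OF coord_ring_subalg]]] by (simp add: coord_ring.simps)

lemma points_subset_coord_ring: "points k \<subseteq> coord_ring k"
proof (induction k)
  case 0
  then show ?case using subalg_0[OF coord_ring_subalg[of 0]] subalg_1[OF coord_ring_subalg[of 0]]
    by (simp add: points_def)
next
  case (Suc k)
  then show ?case using tcoord_in_coord_ring coord_ring_Suc unfolding points_Suc by blast
qed

lemma partial_deriv_points: "b \<in> points k \<Longrightarrow> partial_deriv j b \<in> {0, 1}"
  by (auto simp: points_def partial_deriv_tcoord)

lemma partial_deriv_points_in: "b \<in> points k \<Longrightarrow> partial_deriv j b \<in> coord_ring l"
  using partial_deriv_points[of b k j] subalg_0[OF coord_ring_subalg] subalg_1[OF coord_ring_subalg] by auto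

lemma partial_deriv_new_point: "b \<in> points k \<Longrightarrow> k < j \<Longrightarrow> partial_deriv j b = 0"
  by (auto simp: points_def partial_deriv_tcoord)

text \<open>The derivative by the new variable separates the two: it is \<open>1\<close> on
  \<open>tcoord (Suc k)\<close> and \<open>0\<close> on \<open>b\<close>.\<close>

lemma tcoord_minus_point: "b \<in> points k \<Longrightarrow> tcoord (Suc k) - b \<noteq> 0"
  using partial_deriv_new_point[of b k "Suc k"] partial_deriv_tcoord[of "Suc k" "Suc k"] by auto

lemma coord_ring_const: "c \<in> coord_ring k \<Longrightarrow> k < j \<Longrightarrow> partial_deriv j c = 0"
proof (induction k arbitrary: c)
  case (Suc k)
  from Suc.prems(1) show ?case unfolding coord_ring.simps
  proof (induction rule: adjoin.induct)
    case (pole x b)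
    then show ?case using tcoord_minus_point Suc.prems
      by (simp add: pd.D_divide pd.D_diff partial_deriv_new_point partial_deriv_tcoord)
  qed (use Suc in \<open>auto simp: pd.D_add pd.D_mult partial_deriv_tcoord\<close>)
qed auto

lemma coord_ring_pole:
  "x \<in> coord_ring (Suc k) \<Longrightarrow> b \<in> points k \<Longrightarrow> x / (tcoord (Suc k) - b) \<in> coord_ring (Suc k)"
  by (simp add: coord_ring.simps adjoin.pole)

lemma coord_ring_deriv: "c \<in> coord_ring k \<Longrightarrow> partial_deriv j c \<in> coord_ring k"
proof (induction k arbitrary: c)
  case 0
  then show ?case using subalg_0[OF coord_ring_subalg[of 0]] by auto
next
  case (Suc k)
  let ?t = "tcoord (Suc k)"
  note [intro] = subalg_mult[OF coord_ring_subalg] subalg_add[OF coord_ring_subalg]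
    subalg_diff[OF coord_ring_subalg] coord_ring_pole
  have "x \<in> coord_ring (Suc k) \<and> partial_deriv j x \<in> coord_ring (Suc k)" if "x \<in> coord_ring (Suc k)" for x
    using that[unfolded coord_ring.simps]
  proof (induction rule: adjoin.induct)
    case (base c)
    then show ?case using Suc.IH coord_ring_Suc by blast
  next
    case (add x y)
    then show ?case unfolding pd.D_add by blast
  next
    case (var x)
    have "partial_deriv j ?t \<in> coord_ring (Suc k)"
      by (rule partial_deriv_points_in[of _ "Suc k"]) (simp add: points_Suc)
    with var show ?case unfolding pd.D_mult using tcoord_in_coord_ring by blast
  next
    case (pole x b)
    let ?u = "?t - b"
    have u: "?u \<noteq> 0" using tcoord_minus_point pole by blast
    have eq: "partial_deriv j (x / ?u) = partial_deriv j x / ?u - x * (partial_deriv j ?t - partial_deriv j b) / ?u / ?u"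
      using u by (simp add: pd.D_divide pd.D_diff diff_divide_distrib)
    have "partial_deriv j ?t \<in> coord_ring (Suc k)" "partial_deriv j b \<in> coord_ring (Suc k)"
      using partial_deriv_points_in[of ?t "Suc k"] partial_deriv_points_in[of b k] pole by (simp_all add: points_Suc)
    with pole show ?case unfolding eq
      by (intro conjI coord_ring_pole subalg_mult[OF coord_ring_subalg] subalg_diff[OF coord_ring_subalg]) auto
  qed
  then show ?case using Suc.prems by blast
qed

lemma points_units: "a \<in> points k \<Longrightarrow> b \<in> points k \<Longrightarrow> a \<noteq> b \<Longrightarrow> inverse (a - b) \<in> coord_ring k"
proof (induction k)
  case 0
  have "(of_rat (- 1) :: ratfun) \<in> coord_ring 0" "(of_rat 1 :: ratfun) \<in> coord_ring 0"
    by (simp_all del: of_rat_neg_one of_rat_1)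
  with 0 show ?case by (auto simp: points_def simp del: coord_ring.simps)
next
  case (Suc k)
  have new: "inverse (tcoord (Suc k) - c) \<in> coord_ring (Suc k)" if "c \<in> points k" for c
    using coord_ring_pole[OF subalg_1[OF coord_ring_subalg] that] by (simp add: inverse_eq_divide)
  have sym: "inverse (c - tcoord (Suc k)) \<in> coord_ring (Suc k)" if "c \<in> points k" for c
    using subalg_minus[OF coord_ring_subalg new[OF that]] by (metis inverse_minus_eq minus_diff_eq)
  show ?case using Suc coord_ring_Suc new sym unfolding points_Suc by blast
qed

text \<open>One step of the tower for each \<open>k\<close>: the previous ring consists of constants
  for the derivative by the new variable.\<close>

global_interpretation coord: pole_extension "partial_deriv (Suc k)" "tcoord (Suc k)" "coord_ring k" "points k" for k
  by unfold_locales
    (use points_subset_coord_ring coord_ring_subalg finite_points points_units coord_ring_const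
      partial_deriv_tcoord in auto)

text \<open>The coefficients of exact forms of top degree in \<open>k\<close> variables:
  \<open>g j\<close> is, up to sign, the coefficient of the form omitting \<open>dt\<^sub>j\<close>,
  and the signs of the exterior derivative are absorbed into \<open>g\<close>.\<close>

definition exact_functions :: "nat \<Rightarrow> ratfun set" where
  "exact_functions k = {\<Sum>j=1..k. partial_deriv j (g j) | g. \<forall>j\<in>{1..k}. g j \<in> coord_ring k}"

lemma exact_functionsI:
  "(\<And>j. j \<in> {1..k} \<Longrightarrow> g j \<in> coord_ring k) \<Longrightarrow> x = (\<Sum>j=1..k. partial_deriv j (g j)) \<Longrightarrow> x \<in> exact_functions k"
  unfolding exact_functions_def by blast

lemma exact_functionsE:
  assumes "x \<in> exact_functions k"
  obtains g where "\<forall>j\<in>{1..k}. g j \<in> coord_ring k" "x = (\<Sum>j=1..k. partial_deriv j (g j))"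
  using assms unfolding exact_functions_def by blast

lemma exact_functions_add:
  assumes "x \<in> exact_functions k" "y \<in> exact_functions k"
  shows "x + y \<in> exact_functions k"
proof -
  obtain g where "\<And>j. j \<in> {1..k} \<Longrightarrow> g j \<in> coord_ring k" "x = (\<Sum>j=1..k. partial_deriv j (g j))"
    using exact_functionsE[OF assms(1)] by metis
  moreover obtain h where "\<And>j. j \<in> {1..k} \<Longrightarrow> h j \<in> coord_ring k" "y = (\<Sum>j=1..k. partial_deriv j (h j))"
    using exact_functionsE[OF assms(2)] by metis
  ultimately show ?thesis
    by (intro exact_functionsI[of k "\<lambda>j. g j + h j"])
      (auto simp: pd.D_add sum.distrib intro: subalg_add[OF coord_ring_subalg])
qed

lemma exact_functions_0: "0 \<in> exact_functions k"
  by (rule exact_functionsI[of _ "\<lambda>_. 0"]) (auto intro: subalg_0[OF coord_ring_subalg])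

lemma exact_functions_minus:
  assumes "x \<in> exact_functions k"
  shows "- x \<in> exact_functions k"
proof -
  from assms obtain g where "\<And>j. j \<in> {1..k} \<Longrightarrow> g j \<in> coord_ring k"
    "x = (\<Sum>j=1..k. partial_deriv j (g j))" using exact_functionsE by metis
  then show ?thesis
    by (intro exact_functionsI[of k "\<lambda>j. - g j"])
      (auto simp: pd.D_minus sum_negf intro: subalg_minus[OF coord_ring_subalg])
qed

lemma exact_functions_sum: "(\<And>i. i \<in> I \<Longrightarrow> f i \<in> exact_functions k) \<Longrightarrow> sum f I \<in> exact_functions k"
  by (induction I rule: infinite_finite_induct) (auto intro: exact_functions_add exact_functions_0)

text \<open>If \<open>b\<close> depends on \<open>t\<^sub>j\<close>, the pole moves and contributes
  \<open>e * partial_deriv j b / (t - b) ^ 2\<close> for the new variable \<open>t\<close>. The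
  numerator does not involve \<open>t\<close>, so this is minus the \<open>t\<close>-derivative of a
  simple pole.\<close>

lemma partial_deriv_pole:
  assumes e: "e \<in> coord_ring k" and b: "b \<in> points k" and j: "j \<le> k"
  shows "partial_deriv j (e / (tcoord (Suc k) - b)) = partial_deriv j e / (tcoord (Suc k) - b)
    - partial_deriv (Suc k) (e * partial_deriv j b / (tcoord (Suc k) - b))"
proof -
  let ?t = "tcoord (Suc k)"
  have u: "?t - b \<noteq> 0" by (rule tcoord_minus_point[OF b])
  have c: "e * partial_deriv j b \<in> coord_ring k"
    by (intro subalg_mult[OF coord_ring_subalg] e partial_deriv_points_in[OF b])
  have "partial_deriv (Suc k) (e * partial_deriv j b / (?t - b)) = - (e * partial_deriv j b) / ((?t - b) * (?t - b))"
    using u b coord_ring_const[OF c, of "Suc k"]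
    by (simp add: pd.D_divide pd.D_diff partial_deriv_tcoord partial_deriv_new_point)
  moreover have "partial_deriv j (e / (?t - b)) = partial_deriv j e / (?t - b) + e * partial_deriv j b / ((?t - b) * (?t - b))"
    using u j by (simp add: pd.D_divide pd.D_diff partial_deriv_tcoord add_divide_distrib)
  ultimately show ?thesis by simp
qed

lemma exact_functions_pole:
  assumes x: "x \<in> exact_functions k" and b: "b \<in> points k"
  shows "x / (tcoord (Suc k) - b) \<in> exact_functions (Suc k)"
proof -
  let ?t = "tcoord (Suc k)"
  obtain g where g: "\<And>j. j \<in> {1..k} \<Longrightarrow> g j \<in> coord_ring k" and x: "x = (\<Sum>j=1..k. partial_deriv j (g j))"
    using exact_functionsE[OF x] by metis
  \<comment> \<open>The component of the new variable collects the double poles produced by moving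
    poles.\<close>
  define h where "h j = (if j = Suc k then \<Sum>i=1..k. g i * partial_deriv i b / (?t - b) else g j / (?t - b))" for j
  show ?thesis
  proof (rule exact_functionsI)
    fix j assume j: "j \<in> {1..Suc k}"
    have "g i * partial_deriv i b / (?t - b) \<in> coord_ring (Suc k)" if "i \<in> {1..k}" for i
      by (intro coord_ring_pole b coord_ring_Suc subalg_mult[OF coord_ring_subalg] g that partial_deriv_points_in[OF b])
    then show "h j \<in> coord_ring (Suc k)" using j
      by (cases "j = Suc k") (auto simp: h_def intro!: subalg_sum[OF coord_ring_subalg] coord_ring_pole[OF coord_ring_Suc[OF g] b])
  next
    have "x / (?t - b) = (\<Sum>j=1..k. partial_deriv j (g j) / (?t - b))" by (simp add: x sum_divide_distrib)
    also have "\<dots> = (\<Sum>j=1..k. partial_deriv j (g j / (?t - b)) + partial_deriv (Suc k) (g j * partial_deriv j b / (?t - b)))"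
      by (intro sum.cong refl) (use partial_deriv_pole[OF g b] in auto)
    also have "\<dots> = (\<Sum>j=1..Suc k. partial_deriv j (h j))"
      by (simp add: sum.distrib h_def pd.D_sum)
    finally show "x / (?t - b) = (\<Sum>j=1..Suc k. partial_deriv j (h j))" .
  qed
qed

lemma coord_ring_Suc_decompose:
  assumes "g \<in> coord_ring (Suc k)"
  obtains h c where "h \<in> coord_ring (Suc k)" "\<And>b. b \<in> points k \<Longrightarrow> c b \<in> coord_ring k"
    "g = partial_deriv (Suc k) h + (\<Sum>b\<in>points k. c b / (tcoord (Suc k) - b))"
  using coord.decompose[of g k] assms by (auto simp: coord_ring.simps)

lemma partial_deriv_exact: "h \<in> coord_ring k \<Longrightarrow> j \<in> {1..k} \<Longrightarrow> partial_deriv j h \<in> exact_functions k"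
proof (rule exact_functionsI[of k "\<lambda>i. if i = j then h else 0"])
  assume j: "j \<in> {1..k}"
  have "(\<Sum>i=1..k. partial_deriv i (if i = j then h else 0)) = (\<Sum>i=1..k. if i = j then partial_deriv i h else 0)"
    by (intro sum.cong) auto
  then show "partial_deriv j h = (\<Sum>i=1..k. partial_deriv i (if i = j then h else 0))" using j by simp
qed (auto intro: subalg_0[OF coord_ring_subalg])

text \<open>Decompose the functions of which the derivatives are taken into a derivative by the new
  variable and simple poles. As partial derivatives commute, only the derivatives of the
  coefficients of the poles contribute to the residues.\<close>

lemma residues_of_exact_functions:
  assumes c: "\<And>b. b \<in> points k \<Longrightarrow> c b \<in> coord_ring k"
    and ex: "(\<Sum>b\<in>points k. c b / (tcoord (Suc k) - b)) \<in> exact_functions (Suc k)" and a: "a \<in> points k"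
  shows "c a \<in> exact_functions k"
proof -
  let ?t = "tcoord (Suc k)" and ?D = "partial_deriv (Suc k)"
  obtain g where g: "\<And>j. j \<in> {1..Suc k} \<Longrightarrow> g j \<in> coord_ring (Suc k)"
    and gs: "(\<Sum>b\<in>points k. c b / (?t - b)) = (\<Sum>j=1..Suc k. partial_deriv j (g j))"
    using ex unfolding exact_functions_def by blast
  define Q where "Q j h e \<longleftrightarrow> h \<in> coord_ring (Suc k) \<and> (\<forall>b\<in>points k. e b \<in> coord_ring k)
      \<and> g j = ?D h + (\<Sum>b\<in>points k. e b / (?t - b))" for j h e
  have "\<forall>j\<in>{1..k}. \<exists>h. \<exists>e. Q j h e"
  proof
    fix j assume "j \<in> {1..k}"
    then have "g j \<in> coord_ring (Suc k)" using g by simp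
    then show "\<exists>h. \<exists>e. Q j h e" unfolding Q_def by (rule coord_ring_Suc_decompose) blast
  qed
  then obtain h where "\<forall>j\<in>{1..k}. \<exists>e. Q j (h j) e" by (auto dest!: bchoice)
  then obtain e where Q: "\<forall>j\<in>{1..k}. Q j (h j) (e j)" by (auto dest!: bchoice)
  have h: "\<And>j. j \<in> {1..k} \<Longrightarrow> h j \<in> coord_ring (Suc k)"
    and e: "\<And>j b. j \<in> {1..k} \<Longrightarrow> b \<in> points k \<Longrightarrow> e j b \<in> coord_ring k"
    and ge: "\<And>j. j \<in> {1..k} \<Longrightarrow> g j = ?D (h j) + (\<Sum>b\<in>points k. e j b / (?t - b))"
    using Q unfolding Q_def by blast+
  \<comment> \<open>\<open>H\<close> gathers everything that stands under \<open>?D\<close>, the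
    double poles included; \<open>r b\<close> is the coefficient left at the simple pole
    \<open>b\<close>. Hence the sum of all \<open>r b / (?t - b)\<close> equals \<open>?D H\<close>,
    and its residues vanish.\<close>
  define H where "H = g (Suc k) + (\<Sum>j=1..k. partial_deriv j (h j) - (\<Sum>b\<in>points k. e j b * partial_deriv j b / (?t - b)))"
  define r where "r b = c b - (\<Sum>j=1..k. partial_deriv j (e j b))" for b
  have "partial_deriv j (g j) = ?D (partial_deriv j (h j) - (\<Sum>b\<in>points k. e j b * partial_deriv j b / (?t - b)))
      + (\<Sum>b\<in>points k. partial_deriv j (e j b) / (?t - b))" if j: "j \<in> {1..k}" for j
  proof -
    have "partial_deriv j (g j) = ?D (partial_deriv j (h j)) + (\<Sum>b\<in>points k. partial_deriv j (e j b / (?t - b)))"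
      unfolding ge[OF j] by (simp add: pd.D_add pd.D_sum partial_deriv_commute)
    also have "(\<Sum>b\<in>points k. partial_deriv j (e j b / (?t - b)))
        = (\<Sum>b\<in>points k. partial_deriv j (e j b) / (?t - b) - ?D (e j b * partial_deriv j b / (?t - b)))"
      using partial_deriv_pole[OF e] j by (intro sum.cong) auto
    finally show ?thesis by (simp add: pd.D_diff pd.D_sum sum_subtractf)
  qed
  then have "(\<Sum>b\<in>points k. c b / (?t - b)) = ?D H + (\<Sum>j=1..k. \<Sum>b\<in>points k. partial_deriv j (e j b) / (?t - b))"
    by (simp add: gs H_def pd.D_add pd.D_sum sum.distrib)
  also have "(\<Sum>j=1..k. \<Sum>b\<in>points k. partial_deriv j (e j b) / (?t - b)) = (\<Sum>b\<in>points k. (\<Sum>j=1..k. partial_deriv j (e j b)) / (?t - b))"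
    by (subst sum.swap) (simp add: sum_divide_distrib)
  finally have "(\<Sum>b\<in>points k. r b / (?t - b)) = ?D H"
    by (simp add: r_def diff_divide_distrib sum_subtractf)
  moreover have "H \<in> coord_ring (Suc k)"
    unfolding H_def
    by (intro subalg_add[OF coord_ring_subalg] subalg_sum[OF coord_ring_subalg] subalg_diff[OF coord_ring_subalg]
        g coord_ring_deriv h coord_ring_pole coord_ring_Suc subalg_mult[OF coord_ring_subalg] e partial_deriv_points_in) auto
  moreover have "r b \<in> coord_ring k" if "b \<in> points k" for b
    unfolding r_def using that
    by (intro subalg_sum[OF coord_ring_subalg] subalg_diff[OF coord_ring_subalg] c coord_ring_deriv e) auto
  ultimately have "r a = 0"
    using coord.residue_of_derivative[of H k r a] a by (auto simp: coord_ring.simps)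
  then show ?thesis
    using e a by (intro exact_functionsI[of k "\<lambda>j. e j a"]) (auto simp: r_def)
qed

section \<open>Chains\<close>

text \<open>For \<open>xs = [x\<^sub>1, x\<^sub>2, ...]\<close> this is the inverse of
  \<open>(x\<^sub>1 - z) * (x\<^sub>2 - x\<^sub>1) * ...\<close>, the cell function of the word
  \<open>z # xs\<close>. The start \<open>z\<close> is a separate argument because shuffling and
  inserting behind it leave it fixed.\<close>

primrec chain :: "'a::field \<Rightarrow> 'a list \<Rightarrow> 'a" where
  "chain z [] = 1"
| "chain z (x # xs) = chain x xs / (x - z)"

text \<open>For \<open>p = q = 1\<close> this is a three-term partial fraction identity; the odd
  bracketing is the form in which the terms arise in \<open>chain_shuffle\<close>.\<close>

lemma chain_shuffle_identity:
  fixes x y z p q :: "'a::field"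
  assumes "x \<noteq> z" "y \<noteq> z" "x \<noteq> y"
  shows "p * (q / (y - x)) / (x - z) + p / (x - y) * q / (y - z) = p / (x - z) * (q / (y - z))"
proof -
  define u v where uv: "u = x - z" "v = y - z"
  have yx: "y - x = v - u" "x - y = - (v - u)" by (simp_all add: uv)
  have nz: "u \<noteq> 0" "v \<noteq> 0" "v - u \<noteq> 0" using assms by (auto simp: uv)
  have "p * (q / (v - u)) / u + p / (- (v - u)) * q / v = p * q / (v - u) * (1 / u - 1 / v)"
    by (simp only: divide_inverse inverse_minus_eq) (simp add: right_diff_distrib mult_ac)
  also have "1 / u - 1 / v = (v - u) / (u * v)" using nz by (simp add: diff_divide_distrib)
  finally show ?thesis using nz unfolding yx uv(1)[symmetric] uv(2)[symmetric] by simp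
qed

text \<open>Sort the shuffle by its first letter and apply the induction hypothesis with that letter
  as the new start; the three-term identity adds up the two products. As for iterated integrals, a
  common start turns shuffles into products.\<close>

lemma chain_shuffle:
  assumes "distinct A" "distinct B" "z \<notin> set A" "z \<notin> set B" "set A \<inter> set B = {}"
    and "inj_on f (insert z (set A \<union> set B))"
  shows "(\<Sum>w\<in>shuffles A B. chain (f z) (map f w)) = chain (f z) (map f A) * chain (f z) (map f B)"
  using assms
proof (induction A B arbitrary: z rule: shuffles.induct)
  case (3 x xs y ys)
  have neq: "f x \<noteq> f z" "f y \<noteq> f z" "f x \<noteq> f y" "f y \<noteq> f x"
    using 3(3-8) by (auto simp: inj_on_def)
  have disj: "(#) x ` shuffles xs (y # ys) \<inter> (#) y ` shuffles (x # xs) ys = {}"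
    using 3(3-8) by auto
  have IH: "(\<Sum>w\<in>shuffles xs (y # ys). chain (f x) (map f w)) = chain (f x) (map f xs) * chain (f x) (map f (y # ys))"
    "(\<Sum>w\<in>shuffles (x # xs) ys. chain (f y) (map f w)) = chain (f y) (map f (x # xs)) * chain (f y) (map f ys)"
    by (rule 3(1) 3(2); (rule inj_on_subset[OF 3(8)])?; use 3(3-7) in auto)+
  have "(\<Sum>w\<in>shuffles (x # xs) (y # ys). chain (f z) (map f w))
      = (\<Sum>w\<in>shuffles xs (y # ys). chain (f z) (map f (x # w))) + (\<Sum>w\<in>shuffles (x # xs) ys. chain (f z) (map f (y # w)))"
    by (simp add: sum.union_disjoint[OF _ _ disj] sum.reindex)
  also have "\<dots> = (\<Sum>w\<in>shuffles xs (y # ys). chain (f x) (map f w)) / (f x - f z)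
      + (\<Sum>w\<in>shuffles (x # xs) ys. chain (f y) (map f w)) / (f y - f z)"
    by (simp add: sum_divide_distrib)
  also have "\<dots> = chain (f z) (map f (x # xs)) * chain (f z) (map f (y # ys))"
    unfolding IH using chain_shuffle_identity[of "f x" "f z" "f y" "chain (f x) (map f xs)" "chain (f y) (map f ys)"] neq
    by simp
  finally show ?case .
qed simp_all

text \<open>Without a common start, the split by the first letter leaves two products that differ
  only in a factor \<open>1 / (f y - f x)\<close> against \<open>1 / (f x - f y)\<close>, so they
  cancel.\<close>

lemma chain_shuffle_vanishes:
  assumes "distinct A" "distinct B" "A \<noteq> []" "B \<noteq> []" "set A \<inter> set B = {}"
    and inj: "inj_on f (set A \<union> set B)"
  shows "(\<Sum>w\<in>shuffles A B. chain (f (hd w)) (map f (tl w))) = 0"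
proof -
  obtain x xs y ys where AB: "A = x # xs" "B = y # ys" using assms by (metis list.exhaust)
  have neq: "f x \<noteq> f y" "f y \<noteq> f x" using assms by (auto simp: inj_on_def AB)
  have disj: "(#) x ` shuffles xs (y # ys) \<inter> (#) y ` shuffles (x # xs) ys = {}"
    using assms by (auto simp: AB)
  have "(\<Sum>w\<in>shuffles xs (y # ys). chain (f x) (map f w)) = chain (f x) (map f xs) * chain (f x) (map f (y # ys))"
    "(\<Sum>w\<in>shuffles (x # xs) ys. chain (f y) (map f w)) = chain (f y) (map f (x # xs)) * chain (f y) (map f ys)"
    by (rule chain_shuffle; (rule inj_on_subset[OF inj])?; use assms in \<open>auto simp: AB\<close>)+
  moreover have "(\<Sum>w\<in>shuffles A B. chain (f (hd w)) (map f (tl w)))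
      = (\<Sum>w\<in>shuffles xs (y # ys). chain (f x) (map f w)) + (\<Sum>w\<in>shuffles (x # xs) ys. chain (f y) (map f w))"
    by (simp add: AB sum.union_disjoint[OF _ _ disj] sum.reindex)
  moreover have "p * (q / (f y - f x)) + p / (f x - f y) * q = 0" for p q
  proof -
    have "p / (f x - f y) * q = - (p * (q / (f y - f x)))"
      using minus_divide_right[of "p * q" "f y - f x"] by simp
    then show ?thesis by simp
  qed
  ultimately show ?thesis by simp
qed

section \<open>Inserting a letter into a word\<close>

definition insert_at :: "nat \<Rightarrow> 'a \<Rightarrow> 'a list \<Rightarrow> 'a list" where
  "insert_at p x xs = take p xs @ x # drop p xs"

text \<open>Between neighbours \<open>a\<close> and \<open>b\<close>, the factor
  \<open>1 / (b - a)\<close> becomes \<open>1 / ((t - a) * (b - t))\<close>, which is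
  \<open>1 / (b - a)\<close> times \<open>1 / (t - a) - 1 / (t - b)\<close>. Indices refer to
  \<open>z # ys\<close>, so \<open>p\<close> points at the left neighbour.\<close>

lemma chain_insert_at:
  assumes "distinct (z # ys)" "t \<notin> set (z # ys)" "p \<le> length ys"
  shows "chain z (insert_at p t ys) = chain z ys / (t - (z # ys) ! p)
    - (if p < length ys then chain z ys / (t - (z # ys) ! Suc p) else 0)"
  using assms
proof (induction ys arbitrary: z p)
  case (Cons y ys)
  then have neq: "y \<noteq> z" "t \<noteq> y" "t \<noteq> z" by auto
  show ?case
  proof (cases p)
    case 0
    show ?thesis using neq by (simp add: 0 insert_at_def divide_simps) (simp add: algebra_simps)
  next
    case (Suc q)
    have "chain z (insert_at p t (y # ys)) = chain y (insert_at q t ys) / (y - z)"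
      by (simp add: Suc insert_at_def)
    also have "\<dots> = chain y ys / (t - (y # ys) ! q) / (y - z)
        - (if q < length ys then chain y ys / (t - (y # ys) ! Suc q) else 0) / (y - z)"
      using Cons.IH[of y q] Cons.prems Suc by (auto simp: diff_divide_distrib)
    finally show ?thesis by (simp add: Suc mult.commute)
  qed
qed (simp add: insert_at_def)

definition words :: "'a set \<Rightarrow> 'a list set" where
  "words A = {w. distinct w \<and> set w = A}"

lemma finite_words: "finite A \<Longrightarrow> finite (words A)"
  by (rule finite_subset[OF _ finite_subset_distinct[of A]]) (auto simp: words_def)

lemma insert_at_bij:
  assumes t: "t \<notin> A"
  shows "bij_betw (\<lambda>(w, p). insert_at p t w) (SIGMA w:words A. {..length w}) (words (insert t A))"
proof (rule bij_betwI')
  fix x y assume x: "x \<in> (SIGMA w:words A. {..length w})" and y: "y \<in> (SIGMA w:words A. {..length w})"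
  obtain w p v q where xy: "x = (w, p)" "y = (v, q)" by (cases x, cases y)
  have t: "t \<notin> set w" "t \<notin> set v" using x y t by (auto simp: xy words_def)
  have "w = v \<and> p = q" if "insert_at p t w = insert_at q t v"
  proof -
    have "take p w = take q v \<and> drop p w = drop q v"
      using that t unfolding insert_at_def by (subst (asm) append_Cons_eq_iff) (auto dest: in_set_takeD in_set_dropD)
    moreover from this have "w = v" by (metis append_take_drop_id)
    moreover have "length (take p w) = p" "length (take q v) = q" using x y by (auto simp: xy)
    ultimately show ?thesis by metis
  qed
  then show "((case x of (w, p) \<Rightarrow> insert_at p t w) = (case y of (w, p) \<Rightarrow> insert_at p t w)) = (x = y)"
    by (auto simp: xy)
next
  fix x assume "x \<in> (SIGMA w:words A. {..length w})"
  then obtain w p where x: "x = (w, p)" "w \<in> words A" by auto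
  have "distinct (take p w @ drop p w)" "set (take p w @ drop p w) = A" using x by (simp_all add: words_def)
  then have "distinct (insert_at p t w)" "set (insert_at p t w) = insert t A"
    using t unfolding insert_at_def distinct_append set_append by auto
  then show "(case x of (w, p) \<Rightarrow> insert_at p t w) \<in> words (insert t A)" by (simp add: x words_def)
next
  fix w assume w: "w \<in> words (insert t A)"
  then have "t \<in> set w" by (auto simp: words_def)
  then obtain u v where uv: "w = u @ t # v" by (meson split_list)
  have "u @ v \<in> words A" using w t by (auto simp: words_def uv)
  moreover have "w = insert_at (length u) t (u @ v)" by (simp add: uv insert_at_def)
  ultimately show "\<exists>x\<in>SIGMA w:words A. {..length w}. w = (case x of (w, p) \<Rightarrow> insert_at p t w)"
    by (intro bexI[of _ "(u @ v, length u)"]) auto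
qed

lemma sum_words_insert:
  assumes "finite A" "t \<notin> A"
  shows "sum f (words (insert t A)) = (\<Sum>w\<in>words A. \<Sum>p\<le>length w. f (insert_at p t w))"
  using sum.reindex_bij_betw[OF insert_at_bij[OF assms(2)], of f]
  by (simp add: sum.Sigma finite_words assms case_prod_beta')

section \<open>A basis of the top cohomology\<close>

text \<open>The point \<open>0\<close> is left out because \<open>chain 0\<close> supplies it:
  \<open>w\<close> stands for the word \<open>0 # w\<close>.\<close>

definition chain_words :: "nat \<Rightarrow> ratfun list set" where
  "chain_words k = words (points k - {0})"

lemma finite_chain_words: "finite (chain_words k)"
  by (simp add: chain_words_def finite_words finite_points)

lemma tcoord_notin_points: "tcoord (Suc k) \<notin> points k"
  using tcoord_minus_point by force

lemma zero_in_points: "0 \<in> points k"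
  by (simp add: points_def)

lemma points_Suc_minus: "points (Suc k) - {0} = insert (tcoord (Suc k)) (points k - {0})"
proof -
  have "tcoord (Suc k) \<noteq> 0" using tcoord_notin_points[of k] zero_in_points[of k] by metis
  then show ?thesis by (simp add: points_Suc insert_Diff_if)
qed

lemma sum_chain_words_Suc:
  "sum f (chain_words (Suc k)) = (\<Sum>w\<in>chain_words k. \<Sum>p\<le>length w. f (insert_at p (tcoord (Suc k)) w))"
  unfolding chain_words_def points_Suc_minus
  by (rule sum_words_insert) (auto simp: finite_points tcoord_notin_points)

lemma insert_at_chain_words:
  "w \<in> chain_words k \<Longrightarrow> p \<le> length w \<Longrightarrow> insert_at p (tcoord (Suc k)) w \<in> chain_words (Suc k)"
  using insert_at_bij[of "tcoord (Suc k)" "points k - {0}"] tcoord_notin_points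
  unfolding chain_words_def points_Suc_minus by (force simp: bij_betw_def)

lemma words_singleton: "words {x} = {[x]}"
proof -
  have "w = [x]" if "distinct w" "set w = {x}" for w
  proof -
    have "length w = 1" using distinct_card[OF that(1)] that(2) by simp
    then show ?thesis using that(2) by (cases w) simp_all
  qed
  then show ?thesis by (auto simp: words_def)
qed

lemma chain_words_0: "chain_words 0 = {[1]}"
proof -
  have "points 0 - {0} = {1}" by (auto simp: points_def)
  then show ?thesis by (simp add: chain_words_def words_singleton)
qed

lemma chain_wordsD:
  assumes "w \<in> chain_words k"
  shows "distinct (0 # w)" "set (0 # w) = points k" "tcoord (Suc k) \<notin> set (0 # w)"
proof -
  have w: "distinct w" "set w = points k - {0}" using assms by (simp_all add: chain_words_def words_def)
  then show "distinct (0 # w)" by simp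
  show "set (0 # w) = points k" using w zero_in_points[of k] by (simp add: insert_absorb)
  then show "tcoord (Suc k) \<notin> set (0 # w)" using tcoord_notin_points by simp
qed

text \<open>An insertion position corresponds to its left neighbour. Positions are thereby matched
  with poles, so that passing from insertions to poles is a square system.\<close>

lemma bij_nth_chain_words:
  assumes "w \<in> chain_words k"
  shows "bij_betw ((!) (0 # w)) {..length w} (points k)"
  by (rule bij_betw_nth[OF chain_wordsD(1)[OF assms] _ chain_wordsD(2)[OF assms, symmetric]])
    (simp add: lessThan_Suc_atMost)

lemma chain_insert_at_words:
  assumes "w \<in> chain_words k" "p \<le> length w"
  shows "chain 0 (insert_at p (tcoord (Suc k)) w) = chain 0 w / (tcoord (Suc k) - (0 # w) ! p)
    - (if p < length w then chain 0 w / (tcoord (Suc k) - (0 # w) ! Suc p) else 0)"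
  using chain_wordsD[OF assms(1)] assms(2) by (intro chain_insert_at) auto

lemma chain_in_coord_ring:
  "distinct (z # w) \<Longrightarrow> set (z # w) \<subseteq> points k \<Longrightarrow> chain z w \<in> coord_ring k"
proof (induction w arbitrary: z)
  case (Cons x w)
  have "chain x w * inverse (x - z) \<in> coord_ring k"
    by (intro subalg_mult[OF coord_ring_subalg] points_units Cons.IH; use Cons.prems in simp) auto
  then show ?case by (simp add: divide_inverse)
qed (auto intro: subalg_1[OF coord_ring_subalg])

definition chain_span :: "nat \<Rightarrow> ratfun set" where
  "chain_span k = {\<Sum>w\<in>chain_words k. of_rat (a w) * chain 0 w | a. True}"

lemma chain_span_add:
  assumes "x \<in> chain_span k" "y \<in> chain_span k"
  shows "x + y \<in> chain_span k"
proof -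
  obtain a b where "x = (\<Sum>w\<in>chain_words k. of_rat (a w) * chain 0 w)"
    "y = (\<Sum>w\<in>chain_words k. of_rat (b w) * chain 0 w)"
    using assms unfolding chain_span_def by blast
  then have "x + y = (\<Sum>w\<in>chain_words k. of_rat (a w + b w) * chain 0 w)"
    by (simp add: of_rat_add distrib_right sum.distrib)
  then show ?thesis unfolding chain_span_def by (intro CollectI exI[of _ "\<lambda>w. a w + b w"] conjI TrueI)
qed

lemma chain_span_scale:
  assumes "x \<in> chain_span k"
  shows "of_rat c * x \<in> chain_span k"
proof -
  obtain a where "x = (\<Sum>w\<in>chain_words k. of_rat (a w) * chain 0 w)"
    using assms unfolding chain_span_def by blast
  then have "of_rat c * x = (\<Sum>w\<in>chain_words k. of_rat (c * a w) * chain 0 w)"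
    by (simp add: of_rat_mult sum_distrib_left mult.assoc)
  then show ?thesis unfolding chain_span_def by (intro CollectI exI[of _ "\<lambda>w. c * a w"] conjI TrueI)
qed

lemma chain_span_0: "0 \<in> chain_span k"
  unfolding chain_span_def by (auto intro!: exI[of _ "\<lambda>_. 0"])

lemma chain_span_sum: "(\<And>i. i \<in> I \<Longrightarrow> f i \<in> chain_span k) \<Longrightarrow> sum f I \<in> chain_span k"
  by (induction I rule: infinite_finite_induct) (auto intro: chain_span_add chain_span_0)

lemma chain_span_chain:
  assumes "w \<in> chain_words k"
  shows "chain 0 w \<in> chain_span k"
proof -
  have "(\<Sum>v\<in>chain_words k. of_rat (if v = w then 1 else 0) * chain 0 v)
      = (\<Sum>v\<in>chain_words k. if v = w then chain 0 v else 0)"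
    by (intro sum.cong) auto
  also have "\<dots> = chain 0 w" using assms by (simp add: finite_chain_words)
  finally show ?thesis unfolding chain_span_def
    by (intro CollectI exI[of _ "\<lambda>v. if v = w then 1 else 0"] conjI TrueI) simp
qed

lemma chain_span_pole:
  assumes "x \<in> chain_span k" "b \<in> points k"
  shows "x / (tcoord (Suc k) - b) \<in> chain_span (Suc k)"
proof -
  let ?t = "tcoord (Suc k)"
  have 1: "chain 0 w / (?t - b) \<in> chain_span (Suc k)" if w: "w \<in> chain_words k" for w
  proof -
    have "b \<in> (!) (0 # w) ` {..length w}"
      using bij_nth_chain_words[OF w] assms(2) by (simp add: bij_betw_def)
    then obtain p where p: "p \<le> length w" "b = (0 # w) ! p" by auto
    \<comment> \<open>Back substitution from the end of the word: the last insertion is a single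
      pole, and the pole at position \<open>p\<close> is the insertion at \<open>p\<close> plus the
      pole at \<open>p + 1\<close>.\<close>
    have "chain 0 w / (?t - (0 # w) ! p) \<in> chain_span (Suc k)" using p(1)
    proof (induction p rule: inc_induct)
      case base
      then show ?case
        using chain_span_chain[OF insert_at_chain_words[OF w order_refl]] chain_insert_at_words[OF w order_refl]
        by simp
    next
      case (step p)
      have "chain 0 w / (?t - (0 # w) ! p) = chain 0 (insert_at p ?t w) + chain 0 w / (?t - (0 # w) ! Suc p)"
        using chain_insert_at_words[OF w, of p] step by simp
      then show ?case
        using step.IH chain_span_chain[OF insert_at_chain_words[OF w, of p]] step(2)
        by (auto intro: chain_span_add)
    qed
    then show ?thesis by (simp add: p)
  qed
  obtain a where x: "x = (\<Sum>w\<in>chain_words k. of_rat (a w) * chain 0 w)"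
    using assms(1) unfolding chain_span_def by blast
  have eq: "x / (?t - b) = (\<Sum>w\<in>chain_words k. of_rat (a w) * (chain 0 w / (?t - b)))"
    by (simp add: x sum_divide_distrib)
  show ?thesis unfolding eq by (intro chain_span_sum chain_span_scale 1)
qed

text \<open>By induction, each residue \<open>c b\<close> is a combination of chains up to an exact
  function. Dividing by \<open>?t - b\<close> keeps exact functions exact and sends chains to
  combinations of longer chains.\<close>

theorem coord_ring_eq_exact_plus_chain_span:
  "g \<in> coord_ring k \<Longrightarrow> \<exists>s\<in>chain_span k. g - s \<in> exact_functions k"
proof (induction k arbitrary: g)
  case 0
  then obtain c where g: "g = of_rat c" by auto
  have "of_rat c * chain 0 [1] \<in> chain_span 0"
    by (intro chain_span_scale chain_span_chain) (simp add: chain_words_0)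
  then show ?case using exact_functions_0 by (intro bexI[of _ g]) (auto simp: g)
next
  case (Suc k)
  let ?t = "tcoord (Suc k)"
  obtain h c where h: "h \<in> coord_ring (Suc k)" and c: "\<And>b. b \<in> points k \<Longrightarrow> c b \<in> coord_ring k"
    and g: "g = partial_deriv (Suc k) h + (\<Sum>b\<in>points k. c b / (?t - b))"
    using coord_ring_Suc_decompose[OF Suc.prems] by blast
  obtain s where s: "\<And>b. b \<in> points k \<Longrightarrow> s b \<in> chain_span k"
    "\<And>b. b \<in> points k \<Longrightarrow> c b - s b \<in> exact_functions k"
    using Suc.IH[OF c] by metis
  let ?s = "\<Sum>b\<in>points k. s b / (?t - b)"
  have "g - ?s = partial_deriv (Suc k) h + (\<Sum>b\<in>points k. (c b - s b) / (?t - b))"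
    by (simp add: g diff_divide_distrib sum_subtractf)
  also have "\<dots> \<in> exact_functions (Suc k)"
    by (intro exact_functions_add partial_deriv_exact h exact_functions_sum exact_functions_pole s) auto
  finally show ?case
    by (intro bexI[of _ ?s] chain_span_sum chain_span_pole s)
qed

text \<open>Abel summation: it converts coefficients of insertions into coefficients of poles. The
  coefficient before position \<open>0\<close> counts as \<open>0\<close>.\<close>

lemma sum_telescope_by_parts:
  fixes a e :: "nat \<Rightarrow> 'a::comm_ring_1"
  shows "(\<Sum>p\<le>m. a p * (e p - (if p < m then e (Suc p) else 0)))
    = (\<Sum>p\<le>m. (a p - (if p = 0 then 0 else a (p - 1))) * e p)"
proof -
  have "(\<Sum>p\<le>m. a p * (if p < m then e (Suc p) else 0)) = (\<Sum>p\<le>m. (if p = 0 then 0 else a (p - 1)) * e p)"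
  proof -
    have "(\<Sum>p\<le>m. a p * (if p < m then e (Suc p) else 0)) = (\<Sum>p<m. a p * e (Suc p))"
      by (simp flip: lessThan_Suc_atMost)
    also have "\<dots> = (\<Sum>p\<le>m. (if p = 0 then 0 else a (p - 1)) * e p)"
      by (simp add: sum.atMost_shift)
    finally show ?thesis .
  qed
  then show ?thesis by (simp add: algebra_simps sum_subtractf)
qed

theorem chains_independent_mod_exact:
  "(\<Sum>w\<in>chain_words k. of_rat (a w) * chain 0 w) \<in> exact_functions k \<Longrightarrow> w \<in> chain_words k \<Longrightarrow> a w = 0"
proof (induction k arbitrary: a w)
  case 0
  \<comment> \<open>Without variables only \<open>0\<close> is exact, and the only chain is that of
    \<open>[1]\<close>, which equals \<open>1\<close>.\<close>
  then show ?case by (auto simp: chain_words_0 exact_functions_def)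
next
  case (Suc k)
  let ?t = "tcoord (Suc k)"
  \<comment> \<open>\<open>\<alpha>\<close> holds the coefficients of the insertions,
    \<open>\<beta>\<close> the resulting coefficients of the poles. \<open>\<gamma>\<close> is
    \<open>\<beta>\<close> indexed by points instead of positions, since the same point has
    different positions in different words and the residues are collected by points.\<close>
  define \<alpha> where "\<alpha> w p = a (insert_at p ?t w)" for w p
  define \<beta> where "\<beta> w p = \<alpha> w p - (if p = 0 then 0 else \<alpha> w (p - 1))" for w p
  define \<gamma> where "\<gamma> w b = \<beta> w (the_inv_into {..length w} ((!) (0 # w)) b)" for w b
  have \<gamma>: "\<gamma> w ((0 # w) ! p) = \<beta> w p" if "w \<in> chain_words k" "p \<le> length w" for w p
    using bij_nth_chain_words[OF that(1)] that(2) unfolding \<gamma>_def bij_betw_def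
    by (subst the_inv_into_f_f) auto
  have inner: "(\<Sum>p\<le>length w. of_rat (a (insert_at p ?t w)) * chain 0 (insert_at p ?t w))
      = (\<Sum>b\<in>points k. of_rat (\<gamma> w b) * chain 0 w / (?t - b))" if w: "w \<in> chain_words k" for w
  proof -
    let ?e = "\<lambda>p. chain 0 w / (?t - (0 # w) ! p)"
    have "(\<Sum>p\<le>length w. of_rat (a (insert_at p ?t w)) * chain 0 (insert_at p ?t w))
        = (\<Sum>p\<le>length w. of_rat (\<alpha> w p) * (?e p - (if p < length w then ?e (Suc p) else 0)))"
      unfolding \<alpha>_def by (intro sum.cong refl arg_cong2[where f = "(*)"] chain_insert_at_words w) auto
    also have "\<dots> = (\<Sum>p\<le>length w. (of_rat (\<alpha> w p) - (if p = 0 then 0 else of_rat (\<alpha> w (p - 1)))) * ?e p)"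
      by (rule sum_telescope_by_parts)
    also have "\<dots> = (\<Sum>p\<le>length w. of_rat (\<gamma> w ((0 # w) ! p)) * chain 0 w / (?t - (0 # w) ! p))"
      using \<gamma>[OF w] by (intro sum.cong) (auto simp: \<beta>_def of_rat_diff)
    also have "\<dots> = (\<Sum>b\<in>points k. of_rat (\<gamma> w b) * chain 0 w / (?t - b))"
      by (rule sum.reindex_bij_betw[OF bij_nth_chain_words[OF w]])
    finally show ?thesis .
  qed
  define c where "c b = (\<Sum>w\<in>chain_words k. of_rat (\<gamma> w b) * chain 0 w)" for b
  have "(\<Sum>w\<in>chain_words (Suc k). of_rat (a w) * chain 0 w) = (\<Sum>b\<in>points k. c b / (?t - b))"
    unfolding sum_chain_words_Suc c_def sum_divide_distrib
    by (subst sum.swap) (intro sum.cong refl inner)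
  then have "(\<Sum>b\<in>points k. c b / (?t - b)) \<in> exact_functions (Suc k)" using Suc.prems by simp
  moreover have "c b \<in> coord_ring k" for b
    unfolding c_def using chain_wordsD
    by (intro subalg_sum[OF coord_ring_subalg] subalg_mult[OF coord_ring_subalg] subalg_of_rat[OF coord_ring_subalg]
        chain_in_coord_ring) blast+
  ultimately have "c b \<in> exact_functions k" if "b \<in> points k" for b
    using residues_of_exact_functions that by blast
  then have \<gamma>0: "\<gamma> w b = 0" if "w \<in> chain_words k" "b \<in> points k" for w b
    using Suc.IH[of "\<lambda>w. \<gamma> w b"] that unfolding c_def by blast
  \<comment> \<open>All differences \<open>\<beta>\<close> vanish, and the first of them is
    \<open>\<alpha> w 0\<close> itself, so \<open>\<alpha>\<close> vanishes successively from
    position \<open>0\<close> on.\<close>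
  have \<alpha>0: "\<alpha> w p = 0" if w: "w \<in> chain_words k" and "p \<le> length w" for w p
    using that(2)
  proof (induction p)
    case 0
    have "\<beta> w 0 = 0"
      using \<gamma>[OF w, of 0] \<gamma>0[OF w, of 0] by (simp add: points_def)
    then show ?case by (simp add: \<beta>_def)
  next
    case (Suc p)
    have "(0 # w) ! Suc p \<in> points k" using bij_nth_chain_words[OF w] Suc.prems
      unfolding bij_betw_def by blast
    then have "\<beta> w (Suc p) = 0" using \<gamma>[OF w Suc.prems] \<gamma>0[OF w] by simp
    then show ?case using Suc by (simp add: \<beta>_def)
  qed
  obtain v p where "v \<in> chain_words k" "p \<le> length v" "w = insert_at p ?t v"
    using insert_at_bij[of ?t "points k - {0}"] tcoord_notin_points[of k] Suc.prems(2)
    unfolding chain_words_def points_Suc_minus bij_betw_def by force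
  then show ?case using \<alpha>0 by (simp add: \<alpha>_def)
qed

section \<open>Regular functions and top-degree forms\<close>

lemma embed_0: "embed 0 = 0" and embed_1: "embed 1 = 1"
  by (simp_all add: fract_collapse)

lemma embed_add: "embed (p + q) = embed p + embed q"
  by simp

lemma embed_diff: "embed (p - q) = embed p - embed q"
  by simp

lemma embed_mult: "embed (p * q) = embed p * embed q"
  by simp

lemma embed_power: "embed (p ^ k) = embed p ^ k"
  by (induction k) (simp_all only: power_0 power_Suc embed_1 embed_mult)

lemma embed_sum: "embed (sum f A) = (\<Sum>a\<in>A. embed (f a))"
  by (induction A rule: infinite_finite_induct) (simp_all only: sum.infinite sum.empty sum.insert embed_0 embed_add not_False_eq_True)

lemma embed_prod: "embed (prod f A) = (\<Prod>a\<in>A. embed (f a))"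
  by (induction A rule: infinite_finite_induct) (simp_all only: prod.infinite prod.empty prod.insert embed_1 embed_mult not_False_eq_True)

lemma embed_pvar: "embed (pvar i) = tcoord i"
  by (simp add: tcoord_def)

definition polys_in :: "nat \<Rightarrow> mpoly set" where
  "polys_in N = {p. \<forall>m\<in>Poly_Mapping.keys p. Poly_Mapping.keys m \<subseteq> {1..N}}"

lemma polys_in_add: "p \<in> polys_in N \<Longrightarrow> q \<in> polys_in N \<Longrightarrow> p + q \<in> polys_in N"
  using Poly_Mapping.keys_add[of p q] by (auto simp: polys_in_def)

lemma polys_in_minus: "p \<in> polys_in N \<Longrightarrow> - p \<in> polys_in N"
  by (simp add: polys_in_def)

lemma polys_in_diff: "p \<in> polys_in N \<Longrightarrow> q \<in> polys_in N \<Longrightarrow> p - q \<in> polys_in N"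
  using polys_in_add[of p N "- q"] polys_in_minus by simp

lemma polys_in_mult:
  assumes "p \<in> polys_in N" "q \<in> polys_in N"
  shows "p * q \<in> polys_in N"
  unfolding polys_in_def
proof (intro CollectI ballI)
  fix m assume "m \<in> Poly_Mapping.keys (p * q)"
  then obtain a b where "m = a + b" "a \<in> Poly_Mapping.keys p" "b \<in> Poly_Mapping.keys q"
    using keys_mult[of p q] by blast
  then show "Poly_Mapping.keys m \<subseteq> {1..N}"
    using assms Poly_Mapping.keys_add[of a b] unfolding polys_in_def by blast
qed

lemma polys_in_const: "Poly_Mapping.single 0 c \<in> polys_in N"
  by (simp add: polys_in_def)

lemma polys_in_1: "1 \<in> polys_in N"
  using polys_in_const[of 1] by (simp add: single_one)

lemma polys_in_pvar: "i \<in> {1..N} \<Longrightarrow> pvar i \<in> polys_in N"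
  by (simp add: polys_in_def pvar_def)

lemma polys_in_prod: "(\<And>i. i \<in> I \<Longrightarrow> f i \<in> polys_in N) \<Longrightarrow> prod f I \<in> polys_in N"
  by (induction I rule: infinite_finite_induct) (auto intro: polys_in_mult polys_in_1)

lemma polys_in_power: "p \<in> polys_in N \<Longrightarrow> p ^ k \<in> polys_in N"
  by (induction k) (auto intro: polys_in_mult polys_in_1)

lemma pvar_power: "pvar i ^ k = Poly_Mapping.single (Poly_Mapping.single i k) 1"
proof (induction k)
  case (Suc k)
  have "Poly_Mapping.single i 1 + Poly_Mapping.single i k = Poly_Mapping.single i (Suc k)"
    by (simp flip: single_add)
  then show ?case using Suc by (simp add: pvar_def mult_single)
qed (simp add: single_one)

lemma monomial_eq_prod:
  "Poly_Mapping.single m (1 :: rat) = (\<Prod>i\<in>Poly_Mapping.keys m. pvar i ^ Poly_Mapping.lookup m i)"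
proof -
  have "(\<Prod>i\<in>A. Poly_Mapping.single (f i) (1 :: rat)) = Poly_Mapping.single (sum f A) 1"
    for A :: "nat set" and f :: "nat \<Rightarrow> nat \<Rightarrow>\<^sub>0 nat"
    by (induction A rule: infinite_finite_induct) (simp_all add: single_one mult_single)
  moreover have "(\<Sum>i\<in>Poly_Mapping.keys m. Poly_Mapping.single i (Poly_Mapping.lookup m i)) = m"
    by (intro poly_mapping_eqI) (auto simp: lookup_sum lookup_single when_def in_keys_iff)
  ultimately show ?thesis by (simp add: pvar_power)
qed

lemma tcoord_mem_coord_ring: "i \<in> {1..N} \<Longrightarrow> tcoord i \<in> coord_ring N"
  using points_subset_coord_ring[of N] by (auto simp: points_def)

lemma embed_polys_in:
  assumes "p \<in> polys_in N"
  shows "embed p \<in> coord_ring N"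
proof -
  note R = coord_ring_subalg[of N]
  have mono: "embed (Poly_Mapping.single m c) \<in> coord_ring N" if "Poly_Mapping.keys m \<subseteq> {1..N}" for m c
  proof -
    have "Poly_Mapping.single m c = Poly_Mapping.single 0 c * Poly_Mapping.single m 1"
      by (simp add: mult_single)
    then have "embed (Poly_Mapping.single m c) = of_rat c * (\<Prod>i\<in>Poly_Mapping.keys m. tcoord i ^ Poly_Mapping.lookup m i)"
      by (simp only: embed_mult monomial_eq_prod[of m] embed_prod embed_power embed_pvar
        ratconst_def[symmetric] ratconst_eq_of_rat)
    also have "\<dots> \<in> coord_ring N"
      using that by (intro subalg_mult[OF R] subalg_of_rat[OF R] subalg_prod[OF R] subalg_power[OF R] tcoord_mem_coord_ring) auto
    finally show ?thesis .
  qed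
  have "p = (\<Sum>m\<in>Poly_Mapping.keys p. Poly_Mapping.single m (Poly_Mapping.lookup p m))"
    by (intro poly_mapping_eqI) (auto simp: lookup_sum lookup_single when_def in_keys_iff)
  then have "embed p = (\<Sum>m\<in>Poly_Mapping.keys p. embed (Poly_Mapping.single m (Poly_Mapping.lookup p m)))"
    by (metis (no_types) embed_sum)
  also have "\<dots> \<in> coord_ring N"
    using assms by (intro subalg_sum[OF R] mono) (auto simp: polys_in_def)
  finally show ?thesis .
qed

definition discr_pairs :: "nat \<Rightarrow> (nat \<times> nat) set" where
  "discr_pairs n = {(i, j). 1 \<le> i \<and> i < j \<and> j \<le> n - 2}"

lemma finite_discr_pairs: "finite (discr_pairs n)"
  by (rule finite_subset[of _ "{..n} \<times> {..n}"]) (auto simp: discr_pairs_def)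

lemma discr_eq: "discr n = (\<Prod>i\<in>{1..n-2}. pvar i * (1 - pvar i)) * (\<Prod>(i,j)\<in>discr_pairs n. pvar i - pvar j)"
  by (simp add: discr_def discr_pairs_def)

lemma embed_discr:
  "embed (discr n) = (\<Prod>i\<in>{1..n-2}. tcoord i * (1 - tcoord i)) * (\<Prod>(i,j)\<in>discr_pairs n. tcoord i - tcoord j)"
  by (simp only: discr_eq embed_mult embed_prod embed_pvar embed_diff embed_1 case_prod_beta')

lemma tcoord_inject: "tcoord i = tcoord j \<longleftrightarrow> i = j"
  using partial_deriv_tcoord[of i i] partial_deriv_tcoord[of i j] by (auto split: if_splits)

lemma tcoord_neq_0: "tcoord i \<noteq> 0" and tcoord_neq_1: "tcoord i \<noteq> 1"
  using partial_deriv_tcoord[of i i] by auto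

lemma embed_discr_neq_0: "embed (discr n) \<noteq> 0"
  unfolding embed_discr
  using finite_discr_pairs[of n] tcoord_neq_0 tcoord_neq_1
  by (auto simp: discr_pairs_def tcoord_inject dest!: sym[of 1])

text \<open>Every factor of the discriminant is a difference of two distinct points, hence a unit of
  the coordinate ring.\<close>

lemma inverse_discr: "inverse (embed (discr n)) \<in> coord_ring (n - 2)"
proof -
  note R = coord_ring_subalg[of "n - 2"]
  have i: "inverse (a - b) \<in> coord_ring (n - 2)" if "a \<in> points (n - 2)" "b \<in> points (n - 2)" "a \<noteq> b" for a b
    using points_units that by blast
  have 0: "0 \<in> points (n - 2)" "1 \<in> points (n - 2)" by (simp_all add: points_def)
  have t: "tcoord i \<in> points (n - 2)" if "1 \<le> i" "i \<le> n - 2" for i using that by (simp add: points_def)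
  have "inverse (embed (discr n)) = (\<Prod>i\<in>{1..n-2}. inverse (tcoord i - 0) * inverse (1 - tcoord i))
      * (\<Prod>(i,j)\<in>discr_pairs n. inverse (tcoord i - tcoord j))"
    unfolding embed_discr by (simp add: prod_inversef[symmetric] case_prod_beta' prod.distrib)
  also have "\<dots> \<in> coord_ring (n - 2)"
    unfolding case_prod_beta'
    by (intro subalg_mult[OF R] subalg_prod[OF R] i 0 t)
      (auto simp: discr_pairs_def tcoord_inject tcoord_neq_0 tcoord_neq_1 tcoord_neq_1[symmetric])
  finally show ?thesis .
qed

lemma regular_altdef: "regular n = {embed p / embed (discr n) ^ k | p k. p \<in> polys_in (n - 2)}"
  by (simp add: regular_def polys_in_def)

lemma discr_polys_in: "discr n \<in> polys_in (n - 2)"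
  unfolding discr_eq case_prod_beta'
  by (intro polys_in_mult polys_in_prod polys_in_diff polys_in_pvar polys_in_1) (auto simp: discr_pairs_def)

lemma regularI: "p \<in> polys_in (n - 2) \<Longrightarrow> x = embed p / embed (discr n) ^ k \<Longrightarrow> x \<in> regular n"
  unfolding regular_altdef by blast

lemma regular_embed: "p \<in> polys_in (n - 2) \<Longrightarrow> embed p \<in> regular n"
  by (rule regularI[of _ _ _ 0]) simp_all

lemma regular_add:
  assumes "x \<in> regular n" "y \<in> regular n"
  shows "x + y \<in> regular n"
proof -
  let ?d = "discr n"
  obtain p k q l where pq: "p \<in> polys_in (n - 2)" "q \<in> polys_in (n - 2)"
    and x: "x = embed p / embed ?d ^ k" and y: "y = embed q / embed ?d ^ l"
    using assms unfolding regular_altdef by blast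
  have "x + y = embed (p * ?d ^ l + q * ?d ^ k) / embed ?d ^ (k + l)"
    unfolding x y embed_add embed_mult embed_power power_add
    using embed_discr_neq_0 by (simp add: add_frac_eq del: add_fract mult_fract divide_fract)
  then show ?thesis
    by (rule regularI[rotated]) (intro polys_in_add polys_in_mult polys_in_power pq discr_polys_in)
qed

lemma regular_mult:
  assumes "x \<in> regular n" "y \<in> regular n"
  shows "x * y \<in> regular n"
proof -
  let ?d = "discr n"
  obtain p k q l where pq: "p \<in> polys_in (n - 2)" "q \<in> polys_in (n - 2)"
    and x: "x = embed p / embed ?d ^ k" and y: "y = embed q / embed ?d ^ l"
    using assms unfolding regular_altdef by blast
  have "x * y = embed (p * q) / embed ?d ^ (k + l)"
    unfolding x y embed_mult power_add by (simp del: mult_fract divide_fract)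
  then show ?thesis by (rule regularI[rotated]) (intro polys_in_mult pq)
qed

text \<open>The cofactor \<open>q\<close>, put over the discriminant, is the inverse.\<close>

lemma regular_inverse:
  assumes "q \<in> polys_in (n - 2)" "embed p * embed q = embed (discr n)"
  shows "inverse (embed p) \<in> regular n"
proof -
  have "embed p \<noteq> 0" "embed q \<noteq> 0" using assms(2) embed_discr_neq_0[of n] by (metis mult_zero_left mult_zero_right)+
  then have "inverse (embed p) = embed q / embed (discr n) ^ 1"
    unfolding assms(2)[symmetric] by (simp add: inverse_eq_divide del: divide_fract inverse_fract mult_fract)
  then show ?thesis by (rule regularI[OF assms(1)])
qed

text \<open>The difference is exhibited as a factor of \<open>discr n\<close>. As
  \<open>discr n\<close> contains \<open>1 - t\<^sub>i\<close> and, for \<open>j < i\<close>,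
  \<open>t\<^sub>j - t\<^sub>i\<close>, the cofactor carries a minus sign unless
  \<open>b = 0\<close>.\<close>

lemma regular_inverse_diff:
  assumes i: "i \<in> {1..n-2}" and b: "b \<in> points (i - 1)"
  shows "inverse (tcoord i - b) \<in> regular n"
proof -
  define U V where "U = (\<Prod>i\<in>{1..n-2}. pvar i * (1 - pvar i))"
    and "V = (\<Prod>(i,j)\<in>discr_pairs n. pvar i - pvar j)"
  define U' where "U' = (\<Prod>j\<in>{1..n-2} - {i}. pvar j * (1 - pvar j))"
  have U: "U = pvar i * (1 - pvar i) * U'"
    unfolding U_def U'_def using i by (intro prod.remove) auto
  have d: "discr n = U * V" by (simp add: discr_eq U_def V_def)
  have pU: "U \<in> polys_in (n - 2)" "U' \<in> polys_in (n - 2)" "pvar i \<in> polys_in (n - 2)"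
    unfolding U_def U'_def using i by (auto intro!: polys_in_prod polys_in_mult polys_in_diff polys_in_pvar polys_in_1)
  have pV: "(\<Prod>p\<in>A. pvar (fst p) - pvar (snd p)) \<in> polys_in (n - 2)" if "A \<subseteq> discr_pairs n" for A
    using that by (auto intro!: polys_in_prod polys_in_diff polys_in_pvar simp: discr_pairs_def)
  have V: "V \<in> polys_in (n - 2)" using pV[of "discr_pairs n"] by (simp add: V_def case_prod_beta')
  note [intro] = polys_in_mult polys_in_minus polys_in_diff polys_in_1
  consider "b = 0" | "b = 1" | j where "b = tcoord j" "j \<in> {1..i - 1}"
    using b by (auto simp: points_def)
  then show ?thesis
  proof cases
    case 1
    have "embed (pvar i) * embed ((1 - pvar i) * U' * V) = embed (discr n)"
      unfolding d U by (simp only: embed_mult mult.assoc)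
    then have "inverse (embed (pvar i)) \<in> regular n" by (rule regular_inverse[rotated]) (use pU V in blast)
    then show ?thesis by (simp only: embed_pvar 1 diff_zero)
  next
    case 2
    have "pvar i * (1 - pvar i) * U' * V = (pvar i - 1) * (- (pvar i * U' * V))" by (simp add: algebra_simps)
    then have "embed (pvar i - 1) * embed (- (pvar i * U' * V)) = embed (discr n)"
      unfolding d U by (simp only: embed_mult)
    then have "inverse (embed (pvar i - 1)) \<in> regular n" by (rule regular_inverse[rotated]) (use pU V in blast)
    then show ?thesis by (simp only: embed_pvar 2 embed_diff embed_1)
  next
    case (3 j)
    let ?V' = "\<Prod>p\<in>discr_pairs n - {(j, i)}. pvar (fst p) - pvar (snd p)"
    have "(j, i) \<in> discr_pairs n" using 3 i by (auto simp: discr_pairs_def)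
    then have V': "V = (pvar j - pvar i) * ?V'"
      unfolding V_def case_prod_beta' by (subst prod.remove[OF finite_discr_pairs]) auto
    have "U * ((pvar j - pvar i) * ?V') = (pvar i - pvar j) * (- (U * ?V'))" by (simp add: algebra_simps)
    then have "embed (pvar i - pvar j) * embed (- (U * ?V')) = embed (discr n)"
      unfolding d V' by (simp only: embed_mult)
    moreover have "?V' \<in> polys_in (n - 2)" by (rule pV) auto
    ultimately have "inverse (embed (pvar i - pvar j)) \<in> regular n"
      using pU by (intro regular_inverse[rotated]) blast+
    then show ?thesis by (simp only: embed_pvar 3 embed_diff)
  qed
qed

text \<open>Links the single localization, over which the forms are defined, with the tower, over
  which the inductions run.\<close>

lemma regular_eq_coord_ring: "regular n = coord_ring (n - 2)"
proof
  show "regular n \<subseteq> coord_ring (n - 2)"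
  proof
    fix x assume "x \<in> regular n"
    then obtain p k where p: "p \<in> polys_in (n - 2)" "x = embed p / embed (discr n) ^ k"
      unfolding regular_altdef by blast
    show "x \<in> coord_ring (n - 2)"
      unfolding p(2) divide_inverse power_inverse[symmetric]
      by (intro subalg_mult[OF coord_ring_subalg] subalg_power[OF coord_ring_subalg] embed_polys_in inverse_discr p)
  qed
  \<comment> \<open>\<open>n\<close> stays fixed while the tower is climbed: all stages take their
    inverses from the same \<open>discr n\<close>.\<close>
  have "coord_ring k \<subseteq> regular n" if "k \<le> n - 2" for k
    using that
  proof (induction k)
    case 0
    have "of_rat c \<in> regular n" for c
      using regular_embed[OF polys_in_const[of c]]
      by (simp only: ratconst_def[symmetric] ratconst_eq_of_rat)
    then show ?case by auto
  next
    case (Suc k)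
    have t: "tcoord (Suc k) \<in> regular n"
      using regular_embed[OF polys_in_pvar[of "Suc k" "n - 2"]] Suc.prems by (simp add: embed_pvar)
    show ?case
    proof
      fix x assume "x \<in> coord_ring (Suc k)"
      then show "x \<in> regular n" unfolding coord_ring.simps
      proof (induction rule: adjoin.induct)
        case (pole x b)
        then show ?case
          using regular_mult regular_inverse_diff[of "Suc k" n b] Suc.prems by (simp add: divide_inverse)
      qed (use Suc t regular_add regular_mult in auto)
    qed
  qed
  then show "coord_ring (n - 2) \<subseteq> regular n" by blast
qed

section \<open>Forms of top degree and their classes\<close>

lemma forms_top: "forms n (n - 2) = Poly_Mapping.single {1..n-2} ` coord_ring (n - 2)"
proof
  show "forms n (n - 2) \<subseteq> Poly_Mapping.single {1..n-2} ` coord_ring (n - 2)"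
  proof
    fix \<omega> assume \<omega>: "\<omega> \<in> forms n (n - 2)"
    have keys: "I = {1..n-2}" if "I \<in> Poly_Mapping.keys \<omega>" for I
      using \<omega> that by (intro card_subset_eq) (auto simp: forms_def)
    have "\<omega> = Poly_Mapping.single {1..n-2} (Poly_Mapping.lookup \<omega> {1..n-2})"
      using keys by (intro poly_mapping_eqI) (auto simp: lookup_single when_def in_keys_iff)
    moreover have "Poly_Mapping.lookup \<omega> {1..n-2} \<in> coord_ring (n - 2)"
    proof (cases "{1..n-2} \<in> Poly_Mapping.keys \<omega>")
      case True
      then show ?thesis using \<omega> unfolding forms_def regular_eq_coord_ring by blast
    next
      case False
      then show ?thesis using subalg_0[OF coord_ring_subalg] by (simp add: in_keys_iff)
    qed
    ultimately show "\<omega> \<in> Poly_Mapping.single {1..n-2} ` coord_ring (n - 2)" by (rule image_eqI)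
  qed
  show "Poly_Mapping.single {1..n-2} ` coord_ring (n - 2) \<subseteq> forms n (n - 2)"
    by (auto simp: forms_def regular_eq_coord_ring split: if_splits)
qed

text \<open>No index is left outside \<open>{1..n-2}\<close>, so the inner sum of
  \<open>ext_d\<close> is empty.\<close>

lemma closed_forms_top: "closed_forms n (n - 2) = Poly_Mapping.single {1..n-2} ` coord_ring (n - 2)"
proof -
  have "ext_d n (Poly_Mapping.single {1..n-2} g) = 0" for g
    unfolding ext_d_def by (rule sum.neutral) (auto split: if_splits)
  then show ?thesis unfolding closed_forms_def forms_top by auto
qed

lemma partial_deriv_sign: "partial_deriv j ((-1) ^ k * x) = (-1) ^ k * partial_deriv j x"
  by (cases "even k") (auto simp: pd.D_minus)

text \<open>For \<open>j\<close> in \<open>{1..n-2}\<close> this is \<open>(-1) ^ (j - 1)\<close>,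
  kept in the shape that \<open>ext_d\<close> produces.\<close>

abbreviation (input) dt_sign :: "nat \<Rightarrow> nat \<Rightarrow> ratfun" where
  "dt_sign n j \<equiv> (-1) ^ card {i\<in>{1..n-2} - {j}. i < j}"

text \<open>The only index missing from \<open>{1..n-2} - {j}\<close> is \<open>j\<close>, so each
  component contributes one term. Components outside the support contribute the derivative of
  \<open>0\<close>.\<close>

lemma ext_d_codim1:
  assumes \<omega>: "Poly_Mapping.keys \<omega> \<subseteq> (\<lambda>j. {1..n-2} - {j}) ` {1..n-2}"
  shows "ext_d n \<omega> = Poly_Mapping.single {1..n-2}
    (\<Sum>j=1..n-2. dt_sign n j * partial_deriv j (Poly_Mapping.lookup \<omega> ({1..n-2} - {j})))"
proof -
  let ?T = "\<lambda>I j. Poly_Mapping.single (insert j I)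
       ((-1) ^ card {i\<in>I. i < j} * partial_deriv j (Poly_Mapping.lookup \<omega> I))"
  have inj: "inj_on (\<lambda>j. {1..n-2} - {j}) {1..n-2}" by (rule inj_onI) blast
  have "ext_d n \<omega> = (\<Sum>I\<in>(\<lambda>j. {1..n-2} - {j}) ` {1..n-2}. \<Sum>j\<in>{1..n-2} - I. ?T I j)"
    unfolding ext_d_def using \<omega> by (intro sum.mono_neutral_left) (auto simp: in_keys_iff)
  also have "\<dots> = (\<Sum>j\<in>{1..n-2}. \<Sum>l\<in>{1..n-2} - ({1..n-2} - {j}). ?T ({1..n-2} - {j}) l)"
    using inj by (simp add: sum.reindex)
  also have "\<dots> = (\<Sum>j\<in>{1..n-2}. Poly_Mapping.single {1..n-2}
      (dt_sign n j * partial_deriv j (Poly_Mapping.lookup \<omega> ({1..n-2} - {j}))))"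
  proof (intro sum.cong refl)
    fix j assume j: "j \<in> {1..n-2}"
    then have "{1..n-2} - ({1..n-2} - {j}) = {j}" "insert j ({1..n-2} - {j}) = {1..n-2}" by auto
    then show "(\<Sum>l\<in>{1..n-2} - ({1..n-2} - {j}). ?T ({1..n-2} - {j}) l) = Poly_Mapping.single {1..n-2}
      (dt_sign n j * partial_deriv j (Poly_Mapping.lookup \<omega> ({1..n-2} - {j})))" by simp
  qed
  also have "\<dots> = Poly_Mapping.single {1..n-2}
    (\<Sum>j=1..n-2. dt_sign n j * partial_deriv j (Poly_Mapping.lookup \<omega> ({1..n-2} - {j})))"
    by (intro poly_mapping_eqI) (simp add: lookup_sum lookup_single when_def)
  finally show ?thesis .
qed

lemma when_neq_0D: "(x when P) \<noteq> 0 \<Longrightarrow> P"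
  by (cases P) simp_all

lemma codim1_keys:
  assumes "\<omega> \<in> forms n (n - 3)" "n \<ge> 3"
  shows "Poly_Mapping.keys \<omega> \<subseteq> (\<lambda>j. {1..n-2} - {j}) ` {1..n-2}"
proof
  fix I assume "I \<in> Poly_Mapping.keys \<omega>"
  then have I: "I \<subseteq> {1..n-2}" "card I = n - 3" using assms by (auto simp: forms_def)
  then have "card ({1..n-2} - I) = 1" using assms(2) by (subst card_Diff_subset) (auto intro: finite_subset)
  then obtain j where "{1..n-2} - I = {j}" by (rule card_1_singletonE)
  then show "I \<in> (\<lambda>j. {1..n-2} - {j}) ` {1..n-2}" using I by (intro image_eqI[of _ _ j]) auto
qed

text \<open>The signs in \<open>ext_d\<close> are constants and can be moved into the coefficients,
  so exactness of a top form is exactness of its coefficient.\<close>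

lemma exact_forms_top:
  assumes "n \<ge> 3"
  shows "exact_forms n (n - 2) = Poly_Mapping.single {1..n-2} ` exact_functions (n - 2)"
proof -
  note R = coord_ring_subalg[of "n - 2"]
  have ex: "exact_forms n (n - 2) = ext_d n ` forms n (n - 3)"
  proof -
    have "n - 2 = Suc (n - 3)" using assms by simp
    then show ?thesis by (simp add: exact_forms_def)
  qed
  have sgn: "(-1) ^ k * x \<in> coord_ring (n - 2)" if "x \<in> coord_ring (n - 2)" for k x
    using that subalg_minus[OF R that] by (cases "even k") auto
  show ?thesis unfolding ex
  proof (intro equalityI subsetI)
    fix \<eta> assume "\<eta> \<in> ext_d n ` forms n (n - 3)"
    then obtain \<omega> where \<omega>: "\<omega> \<in> forms n (n - 3)" "\<eta> = ext_d n \<omega>" by blast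
    have c: "Poly_Mapping.lookup \<omega> I \<in> coord_ring (n - 2)" for I
      using \<omega>(1) subalg_0[OF R] unfolding forms_def regular_eq_coord_ring by (cases "I \<in> Poly_Mapping.keys \<omega>") (auto simp: in_keys_iff)
    have "(\<Sum>j=1..n-2. dt_sign n j * partial_deriv j (Poly_Mapping.lookup \<omega> ({1..n-2} - {j}))) \<in> exact_functions (n - 2)"
      by (rule exact_functionsI[of _ "\<lambda>j. dt_sign n j * Poly_Mapping.lookup \<omega> ({1..n-2} - {j})"])
        (auto simp: partial_deriv_sign intro: sgn c)
    then show "\<eta> \<in> Poly_Mapping.single {1..n-2} ` exact_functions (n - 2)"
      unfolding \<omega>(2) ext_d_codim1[OF codim1_keys[OF \<omega>(1) assms]] by (rule imageI)
  next
    fix \<eta> assume "\<eta> \<in> Poly_Mapping.single {1..n-2} ` exact_functions (n - 2)"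
    then obtain h where h: "h \<in> exact_functions (n - 2)" "\<eta> = Poly_Mapping.single {1..n-2} h" by (rule imageE)
    obtain g where g: "\<forall>j\<in>{1..n-2}. g j \<in> coord_ring (n - 2)" and "h = (\<Sum>j=1..n-2. partial_deriv j (g j))"
      using exact_functionsE[OF h(1)] by metis
    then have \<eta>: "\<eta> = Poly_Mapping.single {1..n-2} (\<Sum>j=1..n-2. partial_deriv j (g j))" using h by simp
    \<comment> \<open>The sign placed in the coefficient cancels the one of \<open>ext_d\<close>,
      since its square is \<open>1\<close>.\<close>
    define \<omega> where "\<omega> = (\<Sum>j\<in>{1..n-2}. Poly_Mapping.single ({1..n-2} - {j}) (dt_sign n j * g j))"
    have inj: "{1..n-2} - {j} = {1..n-2} - {i} \<longleftrightarrow> j = i" if "i \<in> {1..n-2}" "j \<in> {1..n-2}" for i j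
      using that by blast
    have lookup: "Poly_Mapping.lookup \<omega> ({1..n-2} - {i}) = dt_sign n i * g i" if i: "i \<in> {1..n-2}" for i
    proof -
      have "Poly_Mapping.lookup \<omega> ({1..n-2} - {i}) = (\<Sum>j\<in>{1..n-2}. if j = i then dt_sign n j * g j else 0)"
        unfolding \<omega>_def lookup_sum lookup_single when_def
        by (intro sum.cong refl) (use inj[OF i] in simp)
      then show ?thesis using i by simp
    qed
    have keys: "Poly_Mapping.keys \<omega> \<subseteq> (\<lambda>j. {1..n-2} - {j}) ` {1..n-2}"
    proof
      fix I assume "I \<in> Poly_Mapping.keys \<omega>"
      then have "(\<Sum>j\<in>{1..n-2}. dt_sign n j * g j when {1..n-2} - {j} = I) \<noteq> 0"
        by (simp add: \<omega>_def in_keys_iff lookup_sum lookup_single)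
      then obtain j where j: "j \<in> {1..n-2}" "(dt_sign n j * g j when {1..n-2} - {j} = I) \<noteq> 0"
        by (rule sum.not_neutral_contains_not_neutral)
      show "I \<in> (\<lambda>j. {1..n-2} - {j}) ` {1..n-2}"
        by (rule image_eqI, rule when_neq_0D[OF j(2), THEN sym], rule j(1))
    qed
    have "\<omega> \<in> forms n (n - 3)"
      unfolding forms_def
    proof (intro CollectI ballI)
      fix I assume "I \<in> Poly_Mapping.keys \<omega>"
      then obtain j where j: "j \<in> {1..n-2}" "I = {1..n-2} - {j}" using keys by blast
      have "card I = n - 3" using j assms by (simp add: card_Diff_singleton)
      moreover have "Poly_Mapping.lookup \<omega> I \<in> regular n"
        using lookup[OF j(1)] sgn g j unfolding regular_eq_coord_ring by simp
      ultimately show "I \<subseteq> {1..n-2} \<and> card I = n - 3 \<and> Poly_Mapping.lookup \<omega> I \<in> regular n"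
        using j by auto
    qed
    moreover have "\<eta> = ext_d n \<omega>"
    proof -
      have "(\<Sum>j=1..n-2. dt_sign n j * partial_deriv j (Poly_Mapping.lookup \<omega> ({1..n-2} - {j})))
          = (\<Sum>j=1..n-2. partial_deriv j (g j))"
      proof (intro sum.cong refl)
        fix j assume "j \<in> {1..n-2}"
        then have "dt_sign n j * partial_deriv j (Poly_Mapping.lookup \<omega> ({1..n-2} - {j}))
            = dt_sign n j * (dt_sign n j * partial_deriv j (g j))"
          using lookup by (simp only: partial_deriv_sign)
        also have "\<dots> = partial_deriv j (g j)"
          by (simp only: mult.assoc[symmetric] power_mult_distrib[symmetric]) simp
        finally show "dt_sign n j * partial_deriv j (Poly_Mapping.lookup \<omega> ({1..n-2} - {j})) = partial_deriv j (g j)" .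
      qed
      then show ?thesis unfolding \<eta> ext_d_codim1[OF keys] by simp
    qed
    ultimately show "\<eta> \<in> ext_d n ` forms n (n - 3)" by (rule image_eqI[rotated])
  qed
qed

lemma single_inject: "Poly_Mapping.single a x = Poly_Mapping.single a y \<longleftrightarrow> x = y"
  by (metis lookup_single_eq)

lemma cohomologous_top:
  assumes "n \<ge> 3" "f \<in> coord_ring (n - 2)" "g \<in> coord_ring (n - 2)"
  shows "(Poly_Mapping.single {1..n-2} f, Poly_Mapping.single {1..n-2} g) \<in> cohomologous n (n - 2)
    \<longleftrightarrow> f - g \<in> exact_functions (n - 2)"
  using assms(2,3) unfolding cohomologous_def closed_forms_top exact_forms_top[OF assms(1)]
  by (auto simp: single_inject simp flip: single_diff)

lemma equiv_cohomologous_top: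
  assumes "n \<ge> 3"
  shows "equiv (closed_forms n (n - 2)) (cohomologous n (n - 2))"
proof (rule equivI)
  show "cohomologous n (n - 2) \<subseteq> closed_forms n (n - 2) \<times> closed_forms n (n - 2)"
    by (auto simp: cohomologous_def)
  let ?E = "exact_forms n (n - 2)"
  have 0: "0 \<in> ?E" unfolding exact_forms_top[OF assms] using exact_functions_0 by (auto intro: image_eqI[of _ _ 0])
  have m: "- \<omega> \<in> ?E" if "\<omega> \<in> ?E" for \<omega>
    using that exact_functions_minus unfolding exact_forms_top[OF assms] by (auto simp flip: single_uminus)
  have a: "\<omega> + \<eta> \<in> ?E" if "\<omega> \<in> ?E" "\<eta> \<in> ?E" for \<omega> \<eta>
    using that exact_functions_add unfolding exact_forms_top[OF assms] by (auto simp flip: single_add)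
  show "refl_on (closed_forms n (n - 2)) (cohomologous n (n - 2))"
    by (rule refl_onI) (simp add: cohomologous_def 0)
  show "sym (cohomologous n (n - 2))"
    by (rule symI) (use m in \<open>force simp: cohomologous_def\<close>)
  show "trans (cohomologous n (n - 2))"
  proof (rule transI)
    fix x y z assume "(x, y) \<in> cohomologous n (n - 2)" "(y, z) \<in> cohomologous n (n - 2)"
    then show "(x, z) \<in> cohomologous n (n - 2)"
      using a[of "x - y" "y - z"] by (simp add: cohomologous_def)
  qed
qed

lemma deRham_class_top_eq_iff:
  assumes "n \<ge> 3" "f \<in> coord_ring (n - 2)" "g \<in> coord_ring (n - 2)"
  shows "deRham_class n (n - 2) (Poly_Mapping.single {1..n-2} f) = deRham_class n (n - 2) (Poly_Mapping.single {1..n-2} g)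
    \<longleftrightarrow> f - g \<in> exact_functions (n - 2)"
  unfolding deRham_class_def cohomologous_top[OF assms, symmetric]
  using assms by (intro eq_equiv_class_iff[OF equiv_cohomologous_top]) (auto simp: closed_forms_top)

lemma deRham_top:
  "deRham n (n - 2) = (\<lambda>g. deRham_class n (n - 2) (Poly_Mapping.single {1..n-2} g)) ` coord_ring (n - 2)"
  unfolding deRham_def closed_forms_top deRham_class_def by (auto simp: quotient_def)

section \<open>Words modulo shuffles\<close>

lemma shuffles_Cons_first: "u @ x # v \<in> shuffles u (x # v)"
  by (induction u) (auto simp: Cons_in_shuffles_iff)

text \<open>As \<open>x\<close> heads its own word, only letters of \<open>u\<close> precede it. If
  all of them do, the word is determined; otherwise the prefix is shorter, which is the measure for
  the reduction modulo shuffles.\<close>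

lemma shuffles_Cons_cases:
  "w \<in> shuffles u (x # v) \<Longrightarrow> w = u @ x # v \<or> (\<exists>u' v'. w = u' @ x # v' \<and> length u' < length u)"
proof (induction u arbitrary: w)
  case (Cons a u)
  then consider w' where "w = a # w'" "w' \<in> shuffles u (x # v)" | w' where "w = x # w'" by auto
  then show ?case
  proof cases
    case 1
    from Cons.IH[OF 1(2)] show ?thesis
    proof
      assume "\<exists>u' v'. w' = u' @ x # v' \<and> length u' < length u"
      then obtain u' v' where "w' = u' @ x # v'" "length u' < length u" by blast
      then show ?thesis using 1(1) by (intro disjI2 exI[of _ "a # u'"] exI[of _ v']) simp
    qed (simp add: 1)
  next
    case 2
    then show ?thesis by (intro disjI2 exI[of _ "[]"] exI[of _ w']) simp
  qed
qed simp

section \<open>Cyclic orderings as pointed words\<close>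

lemma cyc_rotate: "cyc (rotate k xs) = cyc xs"
proof (cases "xs = []")
  case False
  \<comment> \<open>Rotating by \<open>k * (length xs - 1)\<close> undoes the rotation by
    \<open>k\<close>, as both together make \<open>k\<close> full turns.\<close>
  have "rotate j xs = rotate (j + k * (length xs - 1)) (rotate k xs)" for j
  proof -
    have "j + k * (length xs - 1) + k = j + k * length xs"
      using False by (cases "length xs") auto
    then have "rotate (j + k * (length xs - 1)) (rotate k xs) = rotate (j + k * length xs) xs"
      by (simp only: rotate_rotate)
    also have "\<dots> = rotate j xs" by (metis mod_mult_self1 rotate_conv_mod)
    finally show ?thesis by simp
  qed
  moreover have "rotate j (rotate k xs) = rotate (j + k) xs" for j by (simp add: rotate_rotate)
  ultimately show ?thesis unfolding cyc_def by blast
qed simp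

lemma cyclic_orderings_labels: "cyclic_orderings (labels n) = pointed ` words {1..n}"
proof
  show "cyclic_orderings (labels n) \<subseteq> pointed ` words {1..n}"
  proof
    fix c assume "c \<in> cyclic_orderings (labels n)"
    then obtain xs where xs: "c = cyc xs" "distinct xs" "set xs = labels n"
      unfolding cyclic_orderings_def by blast
    then have "D \<in> set xs" by (simp add: labels_def)
    then obtain as bs where ab: "xs = as @ D # bs" by (meson split_list)
    \<comment> \<open>Each rotation class has a listing that ends in \<open>D\<close>.\<close>
    have "rotate (Suc (length as)) xs = bs @ as @ [D]"
      using rotate_append[of "as @ [D]" bs] by (simp add: ab)
    then have c: "c = cyc (bs @ as @ [D])" using cyc_rotate xs(1) by metis
    have Letters: "set (bs @ as) = Letter ` {1..n}"
    proof -
      have "insert D (set (bs @ as)) = insert D (Letter ` {1..n})" "D \<notin> set (bs @ as)"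
        using xs by (auto simp: ab labels_def)
      moreover have "D \<notin> Letter ` {1..n}" by auto
      ultimately show ?thesis by (metis insert_ident)
    qed
    then obtain w where w: "bs @ as = map Letter w"
      by (metis ex_map_conv imageE)
    have "distinct (map Letter w)" unfolding w[symmetric] using xs(2) by (auto simp: ab)
    moreover have "set w = {1..n}" using Letters unfolding w by (auto simp: inj_image_eq_iff inj_def)
    ultimately have "w \<in> words {1..n}" by (simp add: words_def distinct_map)
    moreover have "c = pointed w" unfolding c pointed_def w[symmetric] by simp
    ultimately show "c \<in> pointed ` words {1..n}" by blast
  qed
  show "pointed ` words {1..n} \<subseteq> cyclic_orderings (labels n)"
  proof
    fix c assume "c \<in> pointed ` words {1..n}"
    then obtain w where "c = cyc (map Letter w @ [D])" "distinct w" "set w = {1..n}"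
      by (auto simp: words_def pointed_def)
    then show "c \<in> cyclic_orderings (labels n)"
      unfolding cyclic_orderings_def
      by (intro CollectI exI[of _ "map Letter w @ [D]"]) (auto simp: distinct_map inj_on_def labels_def)
  qed
qed

lemma pointed_inject: "pointed v = pointed w \<longleftrightarrow> v = w"
  by (metis cell_word_pointed)

section \<open>Based words generate the polygons modulo shuffles\<close>

definition word_vector :: "nat list \<Rightarrow> (label list set \<Rightarrow>\<^sub>0 rat)" where
  "word_vector w = Poly_Mapping.single (pointed w) 1"

lemma word_vector_inject: "word_vector v = word_vector w \<longleftrightarrow> v = w"
proof
  assume "word_vector v = word_vector w"
  then have "Poly_Mapping.lookup (word_vector v) (pointed w) = Poly_Mapping.lookup (word_vector w) (pointed w)"
    by simp
  then show "v = w" by (simp add: word_vector_def lookup_single when_def pointed_inject split: if_splits)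
qed simp

lemma pointed_shuffle_eq: "pointed_shuffle A B = sum word_vector (shuffles A B)"
  by (simp add: pointed_shuffle_def word_vector_def)

lemma polygons_expand:
  assumes "x \<in> polygons n"
  shows "x = (\<Sum>w\<in>words {1..n}. scaleQ (Poly_Mapping.lookup x (pointed w)) (word_vector w))"
proof (rule poly_mapping_eqI)
  fix c
  have "Poly_Mapping.lookup (\<Sum>w\<in>words {1..n}. scaleQ (Poly_Mapping.lookup x (pointed w)) (word_vector w)) c
      = (\<Sum>w\<in>words {1..n}. if pointed w = c then Poly_Mapping.lookup x c else 0)"
    unfolding lookup_sum by (intro sum.cong) (auto simp: lookup_scaleQ word_vector_def lookup_single)
  also have "\<dots> = Poly_Mapping.lookup x c"
  proof (cases "c \<in> pointed ` words {1..n}")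
    case True
    then obtain v where v: "v \<in> words {1..n}" "c = pointed v" by blast
    then show ?thesis by (simp add: pointed_inject finite_words)
  next
    case False
    then have "Poly_Mapping.lookup x c = 0"
      using assms by (auto simp: polygons_def cyclic_orderings_labels in_keys_iff)
    then show ?thesis by (simp cong: if_cong)
  qed
  finally show "Poly_Mapping.lookup x c = Poly_Mapping.lookup
    (\<Sum>w\<in>words {1..n}. scaleQ (Poly_Mapping.lookup x (pointed w)) (word_vector w)) c" by simp
qed

lemma subspace_polygons: "free_rat.subspace (polygons n)"
  unfolding free_rat.subspace_def polygons_def
proof (intro conjI ballI allI)
  fix x y :: "label list set \<Rightarrow>\<^sub>0 rat" and c
  assume x: "x \<in> {x. Poly_Mapping.keys x \<subseteq> cyclic_orderings (labels n)}"
  show "scaleQ c x \<in> {x. Poly_Mapping.keys x \<subseteq> cyclic_orderings (labels n)}"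
    using x by (auto simp: in_keys_iff lookup_scaleQ subset_iff)
  assume y: "y \<in> {x. Poly_Mapping.keys x \<subseteq> cyclic_orderings (labels n)}"
  show "x + y \<in> {x. Poly_Mapping.keys x \<subseteq> cyclic_orderings (labels n)}"
    using x y Poly_Mapping.keys_add[of x y] by blast
qed simp

lemma word_vector_in_polygons: "w \<in> words {1..n} \<Longrightarrow> word_vector w \<in> polygons n"
  by (auto simp: polygons_def word_vector_def cyclic_orderings_labels)

definition shuffle_pair :: "nat \<Rightarrow> nat list \<Rightarrow> nat list \<Rightarrow> bool" where
  "shuffle_pair n A B \<longleftrightarrow> A \<noteq> [] \<and> B \<noteq> [] \<and> distinct A \<and> distinct B \<and>
     set A \<inter> set B = {} \<and> set A \<union> set B = {1..n}"

lemma shuffle_space_eq: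
  "shuffle_space n = free_rat.span {pointed_shuffle A B | A B. shuffle_pair n A B}"
  by (simp add: shuffle_space_def shuffle_pair_def)

lemma shuffles_words: "shuffle_pair n A B \<Longrightarrow> shuffles A B \<subseteq> words {1..n}"
  using distinct_disjoint_shuffles[of A B] set_shuffles[of _ A B]
  by (auto simp: shuffle_pair_def words_def)

lemma shuffle_space_subset_polygons: "shuffle_space n \<subseteq> polygons n"
  unfolding shuffle_space_eq
proof (rule free_rat.span_minimal[OF _ subspace_polygons], safe)
  fix A B assume "shuffle_pair n A B"
  then show "pointed_shuffle A B \<in> polygons n"
    unfolding pointed_shuffle_eq using shuffles_words
    by (intro free_rat.subspace_sum[OF subspace_polygons] word_vector_in_polygons) blast
qed

abbreviation (input) based_vectors :: "nat \<Rightarrow> (label list set \<Rightarrow>\<^sub>0 rat) set" where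
  "based_vectors n \<equiv> (\<lambda>v. word_vector (1 # v)) ` words {2..n}"

text \<open>The shuffle of \<open>u\<close> with \<open>1 v\<close> is \<open>u 1 v\<close> plus words in which fewer letters precede \<open>1\<close>.\<close>

lemma word_vector_reduce:
  assumes "u @ 1 # v \<in> words {1..n}"
  shows "word_vector (u @ 1 # v) \<in> free_rat.span ({pointed_shuffle A B | A B. shuffle_pair n A B} \<union> based_vectors n)"
    (is "_ \<in> free_rat.span ?G")
  using assms
proof (induction "length u" arbitrary: u v rule: less_induct)
  case less
  show ?case
  proof (cases "u = []")
    case True
    have "set v = {1..n} - {1}" "distinct v" using less.prems by (auto simp: True words_def)
    moreover have "{1..n} - {1} = {2..n}" by auto
    ultimately have "v \<in> words {2..n}" by (simp add: words_def)
    then show ?thesis using True by (intro free_rat.span_base) auto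
  next
    case False
    have pair: "shuffle_pair n u (1 # v)"
      using less.prems False by (auto simp: shuffle_pair_def words_def)
    have "pointed_shuffle u (1 # v) = word_vector (u @ 1 # v) + sum word_vector (shuffles u (1 # v) - {u @ 1 # v})"
      unfolding pointed_shuffle_eq by (rule sum.remove) (auto simp: shuffles_Cons_first)
    then have eq: "word_vector (u @ 1 # v) = pointed_shuffle u (1 # v) - sum word_vector (shuffles u (1 # v) - {u @ 1 # v})"
      by simp
    have "word_vector w \<in> free_rat.span ?G" if w: "w \<in> shuffles u (1 # v) - {u @ 1 # v}" for w
    proof -
      obtain u' v' where uv: "w = u' @ 1 # v'" "length u' < length u"
        using w shuffles_Cons_cases[of w u 1 v] by blast
      moreover have "w \<in> words {1..n}" using w shuffles_words[OF pair] by blast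
      ultimately show ?thesis using less.hyps by blast
    qed
    then have "sum word_vector (shuffles u (1 # v) - {u @ 1 # v}) \<in> free_rat.span ?G"
      by (rule free_rat.span_sum)
    moreover have "pointed_shuffle u (1 # v) \<in> free_rat.span ?G"
      using pair by (intro free_rat.span_base) blast
    ultimately show ?thesis unfolding eq by (intro free_rat.span_diff)
  qed
qed

text \<open>All word vectors lie in the span of shuffles and based vectors, and this span is the sum
  of the two spans. The based part is an explicit sum over \<open>words {2..n}\<close>, so that its
  coefficients can be compared with those of chains.\<close>

lemma polygons_decompose:
  assumes "n \<ge> 1" "x \<in> polygons n"
  obtains s a where "s \<in> shuffle_space n" "x = s + (\<Sum>v\<in>words {2..n}. scaleQ (a v) (word_vector (1 # v)))"
proof -
  let ?S = "{pointed_shuffle A B | A B. shuffle_pair n A B}"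
  have "x \<in> free_rat.span (?S \<union> based_vectors n)"
  proof (subst polygons_expand[OF assms(2)], intro free_rat.span_sum free_rat.span_scale)
    fix w assume w: "w \<in> words {1..n}"
    then have "1 \<in> set w" using assms(1) by (simp add: words_def)
    then obtain u v where "w = u @ 1 # v" by (meson split_list)
    then show "word_vector w \<in> free_rat.span (?S \<union> based_vectors n)"
      using word_vector_reduce w by blast
  qed
  then obtain s y where sy: "x = s + y" "s \<in> free_rat.span ?S" "y \<in> free_rat.span (based_vectors n)"
    unfolding free_rat.span_Un by blast
  obtain b where "y = (\<Sum>z\<in>based_vectors n. scaleQ (b z) z)"
    using sy(3) free_rat.span_finite[of "based_vectors n"] by (auto simp: finite_words)
  moreover have "inj_on (\<lambda>v. word_vector (1 # v)) (words {2..n})"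
    by (rule inj_onI) (simp add: word_vector_inject)
  ultimately have "y = (\<Sum>v\<in>words {2..n}. scaleQ (b (word_vector (1 # v))) (word_vector (1 # v)))"
    by (simp add: sum.reindex)
  then show ?thesis using that[of s "\<lambda>v. b (word_vector (1 # v))"] sy by (simp add: shuffle_space_eq)
qed

section \<open>The cell-form map\<close>

definition cell_fun :: "nat \<Rightarrow> nat list \<Rightarrow> ratfun" where
  "cell_fun n w = 1 / (\<Prod>k<length w - 1. \<rho> n (w ! Suc k) - \<rho> n (w ! k))"

lemma cell_fun_Cons: "cell_fun n (x # w) = chain (\<rho> n x) (map (\<rho> n) w)"
proof (induction w arbitrary: x)
  case (Cons y w)
  have "cell_fun n (x # y # w) = cell_fun n (y # w) / (\<rho> n y - \<rho> n x)"
    by (simp add: cell_fun_def prod.lessThan_Suc_shift del: prod.lessThan_Suc)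
  then show ?case using Cons.IH by simp
qed (simp add: cell_fun_def)

text \<open>The coefficient function of the representative formed in \<open>cell_map\<close>.
  Shuffles vanish already at this level, as functions and not merely up to exact ones.\<close>

definition cell_sum :: "nat \<Rightarrow> (label list set \<Rightarrow>\<^sub>0 rat) \<Rightarrow> ratfun" where
  "cell_sum n x = (\<Sum>c\<in>Poly_Mapping.keys x. of_rat (Poly_Mapping.lookup x c) * cell_fun n (cell_word c))"

lemma cell_map_eq:
  "cell_map n x = deRham_class n (n - 2) (Poly_Mapping.single {1..n-2} (cell_sum n x))"
proof -
  have "(\<Sum>c\<in>Poly_Mapping.keys x. Poly_Mapping.map ((*) (ratconst (Poly_Mapping.lookup x c))) (cell_form n (cell_word c)))
      = (\<Sum>c\<in>Poly_Mapping.keys x. Poly_Mapping.single {1..n-2} (of_rat (Poly_Mapping.lookup x c) * cell_fun n (cell_word c)))"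
    by (simp add: cell_form_def cell_fun_def ratconst_eq_of_rat)
  also have "\<dots> = Poly_Mapping.single {1..n-2} (cell_sum n x)"
    unfolding cell_sum_def by (intro poly_mapping_eqI) (simp add: lookup_sum lookup_single when_def)
  finally show ?thesis unfolding cell_map_def by simp
qed

lemma cell_sum_superset:
  assumes "finite A" "Poly_Mapping.keys x \<subseteq> A"
  shows "cell_sum n x = (\<Sum>c\<in>A. of_rat (Poly_Mapping.lookup x c) * cell_fun n (cell_word c))"
  unfolding cell_sum_def using assms by (intro sum.mono_neutral_left) (auto simp: in_keys_iff)

lemma cell_sum_add: "cell_sum n (x + y) = cell_sum n x + cell_sum n y"
proof -
  let ?A = "Poly_Mapping.keys x \<union> Poly_Mapping.keys y"
  have "Poly_Mapping.keys (x + y) \<subseteq> ?A" by (rule Poly_Mapping.keys_add)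
  then show ?thesis
    by (simp add: cell_sum_superset[of ?A] lookup_add of_rat_add distrib_right sum.distrib)
qed

lemma cell_sum_scale: "cell_sum n (scaleQ c x) = of_rat c * cell_sum n x"
proof -
  have "Poly_Mapping.keys (scaleQ c x) \<subseteq> Poly_Mapping.keys x"
    by (auto simp: in_keys_iff lookup_scaleQ)
  then show ?thesis
    by (simp add: cell_sum_superset[of "Poly_Mapping.keys x"] lookup_scaleQ of_rat_mult sum_distrib_left mult.assoc)
qed

lemma cell_sum_0 [simp]: "cell_sum n 0 = 0"
  by (simp add: cell_sum_def)

lemma cell_sum_sum: "cell_sum n (sum f A) = (\<Sum>a\<in>A. cell_sum n (f a))"
  by (induction A rule: infinite_finite_induct) (simp_all add: cell_sum_add)

lemma cell_sum_word_vector: "cell_sum n (word_vector w) = cell_fun n w"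
  by (simp add: cell_sum_def word_vector_def cell_word_pointed)

lemma bij_rho:
  assumes "n \<ge> 2"
  shows "bij_betw (\<rho> n) {1..n} (points (n - 2))"
  unfolding bij_betw_def
proof
  show "inj_on (\<rho> n) {1..n}"
    by (rule inj_onI)
      (auto simp: \<rho>_def tcoord_inject tcoord_neq_0 tcoord_neq_1 tcoord_neq_0[symmetric] tcoord_neq_1[symmetric] split: if_splits)
  show "\<rho> n ` {1..n} = points (n - 2)"
  proof (intro equalityI subsetI)
    fix b assume "b \<in> \<rho> n ` {1..n}"
    then obtain i where i: "b = \<rho> n i" "i \<in> {1..n}" by (rule imageE)
    consider "b = 0" | "b = 1" | "i \<noteq> 1" "i \<noteq> n" "b = tcoord (i - 1)"
      using i(1) by (auto simp: \<rho>_def split: if_splits)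
    then show "b \<in> points (n - 2)"
    proof cases
      case 3
      then have "i - 1 \<in> {1..n-2}" using i(2) by auto
      then show ?thesis unfolding points_def 3(3) by blast
    qed (simp_all add: points_def)
  next
    fix b assume "b \<in> points (n - 2)"
    then consider "b = 0" | "b = 1" | j where "j \<in> {1..n-2}" "b = tcoord j" by (auto simp: points_def)
    then show "b \<in> \<rho> n ` {1..n}"
    proof cases
      case 1
      then show ?thesis using assms by (intro image_eqI[of _ _ 1]) (auto simp: \<rho>_def)
    next
      case 2
      then show ?thesis using assms by (intro image_eqI[of _ _ n]) (auto simp: \<rho>_def)
    next
      case (3 j)
      then show ?thesis using assms by (intro image_eqI[of _ _ "Suc j"]) (auto simp: \<rho>_def)
    qed
  qed
qed

lemma bij_betw_words:
  assumes "bij_betw f A B"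
  shows "bij_betw (map f) (words A) (words B)"
proof (rule bij_betw_byWitness[of _ "map (the_inv_into A f)"])
  have f: "inj_on f A" "f ` A = B" using assms by (auto simp: bij_betw_def)
  show "\<forall>w\<in>words A. map (the_inv_into A f) (map f w) = w"
    using f by (auto simp: words_def the_inv_into_f_f intro!: map_idI)
  show "\<forall>w\<in>words B. map f (map (the_inv_into A f) w) = w"
  proof
    fix w assume "w \<in> words B"
    then have "map (\<lambda>y. f (the_inv_into A f y)) w = w"
      using f_the_inv_into_f[OF f(1)] f(2) by (intro map_idI) (simp add: words_def)
    then show "map f (map (the_inv_into A f) w) = w" by (simp add: comp_def)
  qed
  show "map f ` words A \<subseteq> words B" using f by (auto simp: words_def distinct_map)
  have "bij_betw (the_inv_into A f) B A" by (rule bij_betw_the_inv_into[OF assms])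
  then show "map (the_inv_into A f) ` words B \<subseteq> words A"
    by (auto simp: words_def distinct_map bij_betw_def)
qed

text \<open>\<open>\<rho> n\<close> sends the letter \<open>1\<close> to the point \<open>0\<close>,
  so what follows an initial \<open>1\<close> corresponds to what follows an initial
  \<open>0\<close>.\<close>

lemma bij_based_words:
  assumes "n \<ge> 2"
  shows "bij_betw (map (\<rho> n)) (words {2..n}) (chain_words (n - 2))"
proof -
  have "bij_betw (\<rho> n) ({1..n} - {1}) (points (n - 2) - {\<rho> n 1})"
    using bij_rho[OF assms] assms by (intro bij_betw_DiffI) (auto simp: bij_betw_def)
  moreover have "{1..n} - {1} = {2..n}" by auto
  ultimately show ?thesis unfolding chain_words_def by (intro bij_betw_words) (simp add: \<rho>_def)
qed

lemma cell_fun_in_coord_ring: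
  assumes "n \<ge> 2" "w \<in> words {1..n}"
  shows "cell_fun n w \<in> coord_ring (n - 2)"
proof -
  have w: "distinct w" "set w = {1..n}" using assms(2) by (simp_all add: words_def)
  then have "w \<noteq> []" using assms(1) by auto
  then obtain x v where xv: "w = x # v" by (cases w) auto
  have "distinct (map (\<rho> n) w)" "set (map (\<rho> n) w) = points (n - 2)"
    using bij_rho[OF assms(1)] w by (simp_all add: bij_betw_def distinct_map)
  then show ?thesis unfolding xv cell_fun_Cons by (intro chain_in_coord_ring) auto
qed

lemma cell_sum_in_coord_ring:
  assumes "n \<ge> 2" "x \<in> polygons n"
  shows "cell_sum n x \<in> coord_ring (n - 2)"
  by (subst polygons_expand[OF assms(2)], unfold cell_sum_sum cell_sum_scale cell_sum_word_vector)
    (intro subalg_sum[OF coord_ring_subalg] subalg_mult[OF coord_ring_subalg] subalg_of_rat[OF coord_ring_subalg]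
      cell_fun_in_coord_ring assms(1))

lemma cell_sum_based:
  assumes "n \<ge> 2"
  shows "cell_sum n (\<Sum>v\<in>words {2..n}. scaleQ (a (map (\<rho> n) v)) (word_vector (1 # v)))
    = (\<Sum>w\<in>chain_words (n - 2). of_rat (a w) * chain 0 w)"
proof -
  have "cell_sum n (\<Sum>v\<in>words {2..n}. scaleQ (a (map (\<rho> n) v)) (word_vector (1 # v)))
      = (\<Sum>v\<in>words {2..n}. of_rat (a (map (\<rho> n) v)) * chain 0 (map (\<rho> n) v))"
    by (simp add: cell_sum_sum cell_sum_scale cell_sum_word_vector cell_fun_Cons) (simp add: \<rho>_def)
  also have "\<dots> = (\<Sum>w\<in>chain_words (n - 2). of_rat (a w) * chain 0 w)"
    by (rule sum.reindex_bij_betw[OF bij_based_words[OF assms]])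
  finally show ?thesis .
qed

lemma cell_sum_shuffle_space:
  assumes "n \<ge> 2" "x \<in> shuffle_space n"
  shows "cell_sum n x = 0"
proof -
  have "shuffle_space n \<subseteq> {x. cell_sum n x = 0}"
    unfolding shuffle_space_eq
  proof (rule free_rat.span_minimal)
    show "free_rat.subspace {x. cell_sum n x = 0}"
      by (simp add: free_rat.subspace_def cell_sum_add cell_sum_scale)
    show "{pointed_shuffle A B | A B. shuffle_pair n A B} \<subseteq> {x. cell_sum n x = 0}"
    proof safe
      fix A B assume AB: "shuffle_pair n A B"
      have "cell_sum n (pointed_shuffle A B) = (\<Sum>w\<in>shuffles A B. cell_fun n w)"
        by (simp add: pointed_shuffle_eq cell_sum_sum cell_sum_word_vector)
      also have "\<dots> = (\<Sum>w\<in>shuffles A B. chain (\<rho> n (hd w)) (map (\<rho> n) (tl w)))"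
      proof (intro sum.cong refl)
        fix w assume "w \<in> shuffles A B"
        then have "w \<noteq> []" using AB by (auto simp: shuffle_pair_def)
        then show "cell_fun n w = chain (\<rho> n (hd w)) (map (\<rho> n) (tl w))"
          by (cases w) (simp_all add: cell_fun_Cons)
      qed
      also have "\<dots> = 0"
        using AB bij_rho[OF assms(1)] by (intro chain_shuffle_vanishes) (auto simp: shuffle_pair_def bij_betw_def)
      finally show "cell_sum n (pointed_shuffle A B) = 0" .
    qed
  qed
  then show ?thesis using assms(2) by blast
qed

theorem proposition4p1:
  fixes n :: nat
  assumes "n \<ge> 3"
  shows "cell_map n ` polygons n = deRham n (n - 2) \<and>
    {x \<in> polygons n. cell_map n x = deRham_class n (n - 2) 0} = shuffle_space n"
proof
  have n: "n \<ge> 1" "n \<ge> 2" using assms by simp_all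
  let ?cl = "\<lambda>g. deRham_class n (n - 2) (Poly_Mapping.single {1..n-2} g)"
  show "cell_map n ` polygons n = deRham n (n - 2)"
  proof
    show "cell_map n ` polygons n \<subseteq> deRham n (n - 2)"
      unfolding deRham_top cell_map_eq using cell_sum_in_coord_ring[OF n(2)] by blast
    show "deRham n (n - 2) \<subseteq> cell_map n ` polygons n"
      unfolding deRham_top
    proof
      fix c assume "c \<in> ?cl ` coord_ring (n - 2)"
      then obtain g where g: "g \<in> coord_ring (n - 2)" "c = ?cl g" by (rule imageE)
      obtain s where s: "s \<in> chain_span (n - 2)" "g - s \<in> exact_functions (n - 2)"
        using coord_ring_eq_exact_plus_chain_span[OF g(1)] by blast
      obtain a where a: "s = (\<Sum>w\<in>chain_words (n - 2). of_rat (a w) * chain 0 w)"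
        using s(1) unfolding chain_span_def by blast
      define x where "x = (\<Sum>v\<in>words {2..n}. scaleQ (a (map (\<rho> n) v)) (word_vector (1 # v)))"
      have "1 # v \<in> words {1..n}" if "v \<in> words {2..n}" for v
      proof -
        have "insert 1 {2..n} = {1..n}" using n by auto
        then show ?thesis using that by (simp add: words_def)
      qed
      then have x: "x \<in> polygons n"
        unfolding x_def by (intro free_rat.subspace_sum[OF subspace_polygons]
            free_rat.subspace_scale[OF subspace_polygons] word_vector_in_polygons)
      have xs: "cell_sum n x = s" unfolding x_def a by (rule cell_sum_based[OF n(2)])
      have "c = cell_map n x"
        unfolding cell_map_eq xs g(2)
        using deRham_class_top_eq_iff[OF assms g(1)] cell_sum_in_coord_ring[OF n(2) x] s(2) xs by simp
      then show "c \<in> cell_map n ` polygons n" using x by (rule image_eqI)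
    qed
  qed
  have ker: "cell_map n x = deRham_class n (n - 2) 0 \<longleftrightarrow> cell_sum n x \<in> exact_functions (n - 2)"
    if "x \<in> polygons n" for x
    using deRham_class_top_eq_iff[OF assms cell_sum_in_coord_ring[OF n(2) that] subalg_0[OF coord_ring_subalg]]
    by (simp add: cell_map_eq)
  show "{x \<in> polygons n. cell_map n x = deRham_class n (n - 2) 0} = shuffle_space n"
  proof (intro equalityI subsetI)
    fix x assume "x \<in> {x \<in> polygons n. cell_map n x = deRham_class n (n - 2) 0}"
    then have x: "x \<in> polygons n" "cell_sum n x \<in> exact_functions (n - 2)" using ker by auto
    obtain s a where s: "s \<in> shuffle_space n"
      and xs: "x = s + (\<Sum>v\<in>words {2..n}. scaleQ (a v) (word_vector (1 # v)))"
      using polygons_decompose[OF n(1) x(1)] by blast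
    \<comment> \<open>Carries the coefficients from words of letters to words of points, the index
      set of the independence theorem for chains.\<close>
    let ?i = "the_inv_into (words {2..n}) (map (\<rho> n))"
    note bij = bij_based_words[OF n(2)]
    have i: "?i (map (\<rho> n) v) = v" if "v \<in> words {2..n}" for v
      using bij that by (auto simp: bij_betw_def intro: the_inv_into_f_f)
    have xs': "x = s + (\<Sum>v\<in>words {2..n}. scaleQ (a (?i (map (\<rho> n) v))) (word_vector (1 # v)))"
      unfolding xs by (intro arg_cong2[where f = "(+)"] sum.cong refl) (simp add: i)
    have "(\<Sum>w\<in>chain_words (n - 2). of_rat (a (?i w)) * chain 0 w) \<in> exact_functions (n - 2)"
      using x(2) unfolding xs' cell_sum_add cell_sum_shuffle_space[OF n(2) s] cell_sum_based[OF n(2), of "\<lambda>w. a (?i w)"]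
      by simp
    then have "a (?i (map (\<rho> n) v)) = 0" if "v \<in> words {2..n}" for v
      using chains_independent_mod_exact[of "\<lambda>w. a (?i w)" "n - 2"] bij that unfolding bij_betw_def by blast
    then have "x = s" unfolding xs' by simp
    then show "x \<in> shuffle_space n" using s by simp
  next
    fix x assume x: "x \<in> shuffle_space n"
    then have "x \<in> polygons n" using shuffle_space_subset_polygons by blast
    then show "x \<in> {x \<in> polygons n. cell_map n x = deRham_class n (n - 2) 0}"
      using ker cell_sum_shuffle_space[OF n(2) x] exact_functions_0 by simp
  qed
qed

end
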